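(* Let $\mathbf{x}_1,\mathbf{x}_2\in L^2(\mathbb{R})$, let $k\in\mathbb{Q}^+$ and let $\theta\in\mathbb{R}$ with $\theta\notin\pi\mathbb{Z}$. Then the Moyal formula holds: $$\int_{\mathbb{R}}\int_{\mathbb{R}}\mathcal{A}^{\theta,k}_{\mathbf{x}_1}(\tau,u)\left[\mathcal{A}^{\theta,k}_{\mathbf{x}_2}(\tau,u)\right]^*d\tau\,du=\frac{|\Omega_\theta|^2}{k}\left|\langle\mathbf{x}_1,\mathbf{x}_2\rangle\right|^2.$$
   Context: Superscript $*$ denotes complex conjugation and $\langle\mathbf{x}_1,\mathbf{x}_2\rangle=\int_{\mathbb{R}}\mathbf{x}_1(t)\mathbf{x}_2^*(t)\,dt$. $\Omega_\theta=\sqrt{(1-i\cot\theta)/2\pi}$, so $|\Omega_\theta|^2=|\csc\theta|/(2\pi)$. The new fractional ambiguity function (NFrAF) of $\mathbf{x}\in L^2(\mathbb{R})$ with parameters $(\theta,k)$ is $$\mathcal{A}^{\theta,k}_{\mathbf{x}}(\tau,u)=|\Omega_\theta|^2\int_{\mathbb{R}}\mathbf{x}\left(t+k\tfrac{\tau}{2}\right)\mathbf{x}^*\left(t-k\tfrac{\tau}{2}\right)e^{it(k\tau\cot\theta-u\csc\theta)}\,dt.$$ *)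

theory Defs
  imports "HOL-Analysis.Analysis"
begin

(* Representatives of the elements of L^2(R).  Everything defined below depends only on
   the almost-everywhere class of its function arguments (for k nonzero). *)
definition L2_real :: "(real \<Rightarrow> complex) set" where
  "L2_real = {x. x \<in> borel_measurable lebesgue \<and> integrable lebesgue (\<lambda>t. (cmod (x t))\<^sup>2)}"

definition L2_inner :: "(real \<Rightarrow> complex) \<Rightarrow> (real \<Rightarrow> complex) \<Rightarrow> complex" where
  "L2_inner x y = (\<integral>t. x t * cnj (y t) \<partial>lebesgue)"

definition csc :: "real \<Rightarrow> real" where
  "csc \<theta> = 1 / sin \<theta>"

(* Principal branch; only the modulus of Omega is ever used. *)
definition Omega :: "real \<Rightarrow> complex" where
  "Omega \<theta> = csqrt ((1 - \<i> * complex_of_real (cot \<theta>)) / complex_of_real (2 * pi))"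

definition NFrAF :: "real \<Rightarrow> real \<Rightarrow> (real \<Rightarrow> complex) \<Rightarrow> real \<Rightarrow> real \<Rightarrow> complex" where
  "NFrAF \<theta> k x \<tau> u =
     complex_of_real ((cmod (Omega \<theta>))\<^sup>2) *
     (\<integral>t. x (t + k * (\<tau> / 2)) * cnj (x (t - k * (\<tau> / 2))) *
          exp (\<i> * complex_of_real (t * (k * \<tau> * cot \<theta> - u * csc \<theta>))) \<partial>lebesgue)"

end

theory Submission
  imports Defs "HOL-Probability.Characteristic_Functions"
begin

text \<open>
  For fixed \<open>\<tau>\<close> the ambiguity function is, up to the factor \<open>|\<Omega>|\<^sup>2 = |csc \<theta>| / (2 \<pi>)\<close> and an affine
  change of the frequency variable with slope \<open>- csc \<theta>\<close>, the Fourier transform of the lag product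
  \<open>t \<mapsto> x (t + k \<tau> / 2) x\<^sup>* (t - k \<tau> / 2)\<close>. The lag product is integrable for every \<open>\<tau>\<close>, and square
  integrable for almost every \<open>\<tau>\<close>. Parseval's formula in \<open>u\<close> therefore turns the double
  integral into \<open>|\<Omega>|\<^sup>2\<close> times the integral of the product of one lag product with the conjugate of
  the other; the change of variables \<open>a = t + k \<tau> / 2\<close>, \<open>b = t - k \<tau> / 2\<close>, of Jacobian \<open>k\<close>,
  splits this into \<open>1 / k\<close> times the inner product and its conjugate
  (\<open>integral_sheared_product\<close>, \<open>Moyal_ambiguity\<close>). The diagonal case \<open>x\<^sub>1 = x\<^sub>2\<close> shows that the
  ambiguity functions are square integrable on the plane, which gives the joint integrability and
  justifies the interchange of the integrals.

  Parseval's formula for functions that are both integrable and square integrable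
  (\<open>Parseval_L1_L2\<close>) follows by polarization from Plancherel's (\<open>Plancherel_L1_L2\<close>). For the
  latter, the energy of the transform is damped by a Gaussian of width \<open>a\<close>. By Fubini's theorem
  and the characteristic function of the normal distribution, the damped energy is \<open>2 \<pi>\<close> times an
  average of the autocorrelation of \<open>f\<close> over normally distributed lags of standard deviation
  \<open>1 / a\<close> (\<open>damped_autocorrelation\<close>). As \<open>a\<close> tends to infinity this tends to the energy of \<open>f\<close>,
  because translations are continuous in mean square (\<open>translation_continuous_L2\<close>).

  All of this is done for Borel functions and Borel measure; a Lebesgue measurable function
  agrees almost everywhere with a Borel one, and the ambiguity function does not see the difference.
\<close>

section \<open>Square integrable functions\<close>

lemma cmod_mult_le_sum_squares: "cmod a * cmod b \<le> (cmod a)\<^sup>2 + (cmod b)\<^sup>2"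
  using sum_squares_bound[of "cmod a" "cmod b"] mult_nonneg_nonneg[OF norm_ge_zero norm_ge_zero, of a b]
  by linarith

lemma integrable_mult_of_L2:
  fixes f g :: "'a \<Rightarrow> complex"
  assumes [measurable]: "f \<in> borel_measurable M" "g \<in> borel_measurable M"
    and f: "integrable M (\<lambda>t. (cmod (f t))\<^sup>2)" and g: "integrable M (\<lambda>t. (cmod (g t))\<^sup>2)"
  shows "integrable M (\<lambda>t. f t * g t)"
proof (rule Bochner_Integration.integrable_bound)
  show "integrable M (\<lambda>t. (cmod (f t))\<^sup>2 + (cmod (g t))\<^sup>2)"
    using f g by simp
  show "AE t in M. norm (f t * g t) \<le> norm ((cmod (f t))\<^sup>2 + (cmod (g t))\<^sup>2)"
    using cmod_mult_le_sum_squares by (simp add: norm_mult)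
qed simp

lemma cmod_add_squared_le: "(cmod (a + b))\<^sup>2 \<le> 2 * (cmod a)\<^sup>2 + 2 * (cmod b)\<^sup>2"
proof -
  have "(cmod (a + b))\<^sup>2 \<le> (cmod a + cmod b)\<^sup>2"
    by (intro power_mono norm_triangle_ineq) auto
  also have "\<dots> \<le> 2 * (cmod a)\<^sup>2 + 2 * (cmod b)\<^sup>2"
    using sum_squares_bound[of "cmod a" "cmod b"] by (simp add: power2_sum)
  finally show ?thesis .
qed

lemma cmod_diff_squared_le: "(cmod (a - b))\<^sup>2 \<le> 2 * (cmod a)\<^sup>2 + 2 * (cmod b)\<^sup>2"
  using cmod_add_squared_le[of a "- b"] by simp

lemma L2_diff:
  fixes f g :: "'a \<Rightarrow> complex"
  assumes [measurable]: "f \<in> borel_measurable M" "g \<in> borel_measurable M"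
    and f: "integrable M (\<lambda>t. (cmod (f t))\<^sup>2)" and g: "integrable M (\<lambda>t. (cmod (g t))\<^sup>2)"
  shows "integrable M (\<lambda>t. (cmod (f t - g t))\<^sup>2)"
proof (rule Bochner_Integration.integrable_bound)
  show "integrable M (\<lambda>t. 2 * (cmod (f t))\<^sup>2 + 2 * (cmod (g t))\<^sup>2)"
    using f g by simp
  show "AE t in M. norm ((cmod (f t - g t))\<^sup>2) \<le> norm (2 * (cmod (f t))\<^sup>2 + 2 * (cmod (g t))\<^sup>2)"
    using cmod_diff_squared_le by simp
qed simp

lemma L2_add:
  fixes f g :: "'a \<Rightarrow> complex"
  assumes [measurable]: "f \<in> borel_measurable M" "g \<in> borel_measurable M"
    and f: "integrable M (\<lambda>t. (cmod (f t))\<^sup>2)" and g: "integrable M (\<lambda>t. (cmod (g t))\<^sup>2)"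
  shows "integrable M (\<lambda>t. (cmod (f t + g t))\<^sup>2)"
  using L2_diff[of f M "\<lambda>t. - g t"] assms by simp

section \<open>Approximation in mean square by continuous functions of compact support\<close>

text \<open>The radial retraction of the plane onto the closed disc of radius \<open>M > 0\<close>.\<close>
definition trunc :: "real \<Rightarrow> complex \<Rightarrow> complex" where
  "trunc M z = of_real (M / max M (cmod z)) * z"

lemma trunc_eq: "M > 0 \<Longrightarrow> cmod z \<le> M \<Longrightarrow> trunc M z = z"
  by (simp add: trunc_def max_def)

lemma cmod_trunc_le: "M > 0 \<Longrightarrow> cmod (trunc M z) \<le> M"
  by (auto simp add: trunc_def max_def norm_mult norm_divide field_simps abs_if)

lemma continuous_trunc: "M > 0 \<Longrightarrow> continuous_on S (trunc M)"
  unfolding trunc_def by (intro continuous_intros) (auto simp: max_def split: if_splits)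

text \<open>A continuous bump: 1 on \<open>[-M, M]\<close>, 0 outside \<open>[-M - 1, M + 1]\<close>, linear in between.\<close>
definition cutoff :: "real \<Rightarrow> real \<Rightarrow> real" where
  "cutoff M t = max 0 (min 1 (M + 1 - \<bar>t\<bar>))"

lemma continuous_cutoff: "continuous_on S (cutoff M)"
  unfolding cutoff_def by (intro continuous_intros)

lemma cutoff_bounds: "0 \<le> cutoff M t" "cutoff M t \<le> 1" "\<bar>t\<bar> \<le> M \<Longrightarrow> cutoff M t = 1"
   "\<bar>t\<bar> > M + 1 \<Longrightarrow> cutoff M t = 0"
  by (auto simp: cutoff_def)

text \<open>
  A measurable function is almost everywhere a pointwise limit of continuous functions. Retracting
  these onto the disc of radius \<open>M\<close> and cutting them off preserves the limit and supplies an
  integrable majorant, so that the convergence takes place in mean square.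
\<close>
lemma cont_L2_dense_bounded:
  fixes f :: "real \<Rightarrow> complex"
  assumes f[measurable]: "f \<in> borel_measurable borel" and M: "M > 0"
    and bd: "\<And>t. cmod (f t) \<le> M" and supp: "\<And>t. \<bar>t\<bar> > M \<Longrightarrow> f t = 0" and e: "\<epsilon> > 0"
  obtains g where "continuous_on UNIV g" "\<And>t. \<bar>t\<bar> > M + 1 \<Longrightarrow> g t = 0" "\<And>t. cmod (g t) \<le> M"
    "(\<integral>t. (cmod (f t - g t))\<^sup>2 \<partial>lborel) < \<epsilon>"
proof -
  have "f \<in> borel_measurable lebesgue"
    using f by (simp add: measurable_completion)
  then have "f measurable_on UNIV"
    by (rule lebesgue_measurable_imp_measurable_on) simp
  then obtain N g0 where N: "negligible N" and g0: "\<And>n. continuous_on UNIV (g0 n :: real \<Rightarrow> complex)"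
    and lim: "\<And>x. x \<notin> N \<Longrightarrow> (\<lambda>n. g0 n x) \<longlonglongrightarrow> f x"
    unfolding measurable_on_def by auto
  define g where "g n t = of_real (cutoff M t) * trunc M (g0 n t)" for n :: nat and t
  have cont: "continuous_on UNIV (g n)" for n
    unfolding g_def
    by (intro continuous_intros continuous_cutoff continuous_on_compose2[OF continuous_trunc[OF M, of UNIV] g0]) auto
  then have [measurable]: "g n \<in> borel_measurable borel" for n
    by (rule borel_measurable_continuous_onI)
  have supp_g: "g n t = 0" if "\<bar>t\<bar> > M + 1" for n t
    using that by (simp add: g_def cutoff_bounds)
  have bd_g: "cmod (g n t) \<le> M" for n t
    using mult_mono[OF cutoff_bounds(2)[of M t] cmod_trunc_le[OF M, of "g0 n t"]] cutoff_bounds(1)[of M t]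
    by (simp add: g_def norm_mult)
  have lim_g: "(\<lambda>n. g n t) \<longlonglongrightarrow> f t" if "t \<notin> N" for t
  proof -
    have "isCont (trunc M) (f t)"
      using continuous_trunc[OF M, of UNIV] by (simp add: continuous_on_eq_continuous_at)
    then have "(\<lambda>n. trunc M (g0 n t)) \<longlonglongrightarrow> trunc M (f t)"
      using lim[OF that] by (rule isCont_tendsto_compose)
    then have "(\<lambda>n. g n t) \<longlonglongrightarrow> of_real (cutoff M t) * trunc M (f t)"
      unfolding g_def by (intro tendsto_intros)
    moreover have "of_real (cutoff M t) * trunc M (f t) = f t"
      using trunc_eq[OF M bd[of t]] supp[of t] cutoff_bounds(3)[of t M] by (cases "\<bar>t\<bar> \<le> M") auto
    ultimately show ?thesis by simp
  qed
  have AE_N: "AE t in lborel. t \<notin> N"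
  proof -
    have "AE t in lebesgue. t \<notin> N"
      using N by (intro AE_not_in) (simp add: negligible_iff_null_sets)
    then show ?thesis
      by (simp add: AE_completion_iff)
  qed
  have "(\<lambda>n. \<integral>t. (cmod (f t - g n t))\<^sup>2 \<partial>lborel) \<longlonglongrightarrow> (\<integral>t. 0 \<partial>(lborel :: real measure))"
  proof (rule integral_dominated_convergence)
    show "integrable lborel (\<lambda>t. 4 * M\<^sup>2 * indicator {-(M+1)..M+1} t :: real)"
      by (intro integrable_mult_right integrable_real_indicator) (simp_all add: emeasure_lborel_Icc_eq)
    show "AE t in lborel. (\<lambda>n. (cmod (f t - g n t))\<^sup>2) \<longlonglongrightarrow> 0"
      using AE_N
    proof eventually_elim
      case (elim t)
      have "(\<lambda>n. (cmod (f t - g n t))\<^sup>2) \<longlonglongrightarrow> (cmod (f t - f t))\<^sup>2"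
        by (intro tendsto_intros lim_g elim)
      then show ?case by simp
    qed
    show "AE t in lborel. norm ((cmod (f t - g n t))\<^sup>2) \<le> 4 * M\<^sup>2 * indicator {-(M+1)..M+1} t" for n
    proof (rule AE_I2)
      fix t
      show "norm ((cmod (f t - g n t))\<^sup>2) \<le> 4 * M\<^sup>2 * indicator {-(M+1)..M+1} t"
      proof (cases "\<bar>t\<bar> > M + 1")
        case True
        then show ?thesis using supp[of t] supp_g[of t n] by simp
      next
        case False
        have "(cmod (f t - g n t))\<^sup>2 \<le> 2 * (cmod (f t))\<^sup>2 + 2 * (cmod (g n t))\<^sup>2"
          by (rule cmod_diff_squared_le)
        also have "\<dots> \<le> 2 * M\<^sup>2 + 2 * M\<^sup>2"
          by (intro add_mono mult_left_mono power_mono bd bd_g) auto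
        finally show ?thesis using False by (auto simp: indicator_def)
      qed
    qed
  qed simp_all
  then have "\<forall>\<^sub>F n in sequentially. (\<integral>t. (cmod (f t - g n t))\<^sup>2 \<partial>lborel) < \<epsilon>"
    using e by (intro order_tendstoD(2)) auto
  then obtain n where "(\<integral>t. (cmod (f t - g n t))\<^sup>2 \<partial>lborel) < \<epsilon>"
    by (auto simp: eventually_sequentially)
  with that[OF cont supp_g bd_g] show ?thesis by blast
qed

lemma eventually_le_real_nat: "\<forall>\<^sub>F n in sequentially. c \<le> real n"
  using filterlim_real_sequentially by (simp add: filterlim_at_top)

text \<open>Truncation in both domain and range, with dominated convergence.\<close>
lemma L2_bounded_dense:
  fixes f :: "real \<Rightarrow> complex"
  assumes f[measurable]: "f \<in> borel_measurable borel"
    and L2: "integrable lborel (\<lambda>t. (cmod (f t))\<^sup>2)" and e: "\<epsilon> > 0"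
  obtains g M where "g \<in> borel_measurable borel" "M > 0" "\<And>t. cmod (g t) \<le> M" "\<And>t. \<bar>t\<bar> > M \<Longrightarrow> g t = 0"
    "(\<integral>t. (cmod (f t - g t))\<^sup>2 \<partial>lborel) < \<epsilon>"
proof -
  define g where "g n t = (if \<bar>t\<bar> \<le> real (Suc n) \<and> cmod (f t) \<le> real (Suc n) then f t else 0)" for n t
  have [measurable]: "g n \<in> borel_measurable borel" for n
    unfolding g_def by measurable
  have "(\<lambda>n. \<integral>t. (cmod (f t - g n t))\<^sup>2 \<partial>lborel) \<longlonglongrightarrow> (\<integral>t. 0 \<partial>(lborel :: real measure))"
  proof (rule integral_dominated_convergence[OF _ _ L2])
    show "AE t in lborel. (\<lambda>n. (cmod (f t - g n t))\<^sup>2) \<longlonglongrightarrow> 0"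
    proof (rule AE_I2)
      fix t
      have "\<forall>\<^sub>F n in sequentially. max \<bar>t\<bar> (cmod (f t)) \<le> real n"
        by (rule eventually_le_real_nat)
      then have "\<forall>\<^sub>F n in sequentially. (cmod (f t - g n t))\<^sup>2 = 0"
        by eventually_elim (auto simp: g_def)
      then show "(\<lambda>n. (cmod (f t - g n t))\<^sup>2) \<longlonglongrightarrow> 0"
        by (rule tendsto_eventually)
    qed
    show "AE t in lborel. norm ((cmod (f t - g n t))\<^sup>2) \<le> (cmod (f t))\<^sup>2" for n
      by (rule AE_I2) (simp add: g_def)
  qed simp_all
  then have "\<forall>\<^sub>F n in sequentially. (\<integral>t. (cmod (f t - g n t))\<^sup>2 \<partial>lborel) < \<epsilon>"
    using e by (intro order_tendstoD(2)) auto
  then obtain n where "(\<integral>t. (cmod (f t - g n t))\<^sup>2 \<partial>lborel) < \<epsilon>"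
    by (auto simp: eventually_sequentially)
  then show ?thesis
    by (intro that[of "g n" "real (Suc n)"]) (simp_all add: g_def)
qed

lemma L2_of_bounded_support:
  fixes g :: "real \<Rightarrow> complex"
  assumes [measurable]: "g \<in> borel_measurable borel"
    and supp: "\<And>t. \<bar>t\<bar> > K \<Longrightarrow> g t = 0" and bd: "\<And>t. cmod (g t) \<le> M"
  shows "integrable lborel (\<lambda>t. (cmod (g t))\<^sup>2)"
proof (rule Bochner_Integration.integrable_bound)
  show "integrable lborel (\<lambda>t. M\<^sup>2 * indicator {-K..K} t :: real)"
    by (intro integrable_mult_right integrable_real_indicator) (simp_all add: emeasure_lborel_Icc_eq)
  show "AE t in lborel. norm ((cmod (g t))\<^sup>2) \<le> norm (M\<^sup>2 * indicator {-K..K} t :: real)"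
  proof (rule AE_I2)
    fix t
    have "(cmod (g t))\<^sup>2 \<le> M\<^sup>2"
      by (intro power_mono bd) simp
    then show "norm ((cmod (g t))\<^sup>2) \<le> norm (M\<^sup>2 * indicator {-K..K} t :: real)"
      using supp[of t] by (cases "\<bar>t\<bar> \<le> K") (auto simp: indicator_def)
  qed
qed simp

lemma L2_compact_dense:
  fixes f :: "real \<Rightarrow> complex"
  assumes f[measurable]: "f \<in> borel_measurable borel"
    and L2: "integrable lborel (\<lambda>t. (cmod (f t))\<^sup>2)" and e: "\<epsilon> > 0"
  obtains g K M where "continuous_on UNIV g" "\<And>t. \<bar>t\<bar> > K \<Longrightarrow> g t = 0" "\<And>t. cmod (g t) \<le> M"
    "(\<integral>t. (cmod (f t - g t))\<^sup>2 \<partial>lborel) < \<epsilon>"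
proof -
  have e4: "\<epsilon> / 4 > 0" using e by simp
  obtain b M where b[measurable]: "b \<in> borel_measurable borel" and M: "M > 0"
    and bM: "\<And>t. cmod (b t) \<le> M" "\<And>t. \<bar>t\<bar> > M \<Longrightarrow> b t = 0"
    and fb: "(\<integral>t. (cmod (f t - b t))\<^sup>2 \<partial>lborel) < \<epsilon> / 4"
    using L2_bounded_dense[OF f L2 e4] by metis
  obtain g where g: "continuous_on UNIV g" "\<And>t. \<bar>t\<bar> > M + 1 \<Longrightarrow> g t = 0" "\<And>t. cmod (g t) \<le> M"
    and bg: "(\<integral>t. (cmod (b t - g t))\<^sup>2 \<partial>lborel) < \<epsilon> / 4"
    using cont_L2_dense_bounded[OF b M bM e4] by metis
  have g_meas[measurable]: "g \<in> borel_measurable borel"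
    using g(1) by (rule borel_measurable_continuous_onI)
  have L2b: "integrable lborel (\<lambda>t. (cmod (b t))\<^sup>2)"
    using bM by (intro L2_of_bounded_support[of b M M]) auto
  have L2g: "integrable lborel (\<lambda>t. (cmod (g t))\<^sup>2)"
    using g by (intro L2_of_bounded_support[of g "M + 1" M]) auto
  have 1: "integrable lborel (\<lambda>t. (cmod (f t - b t))\<^sup>2)" "integrable lborel (\<lambda>t. (cmod (b t - g t))\<^sup>2)"
    "integrable lborel (\<lambda>t. (cmod (f t - g t))\<^sup>2)"
    using L2 L2b L2g by (auto intro!: L2_diff)
  have "(\<integral>t. (cmod (f t - g t))\<^sup>2 \<partial>lborel)
    \<le> (\<integral>t. 2 * (cmod (f t - b t))\<^sup>2 + 2 * (cmod (b t - g t))\<^sup>2 \<partial>lborel)"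
  proof (intro integral_mono 1 Bochner_Integration.integrable_add integrable_mult_right)
    show "(cmod (f t - g t))\<^sup>2 \<le> 2 * (cmod (f t - b t))\<^sup>2 + 2 * (cmod (b t - g t))\<^sup>2" for t
      using cmod_add_squared_le[of "f t - b t" "b t - g t"] by simp
  qed
  also have "\<dots> = 2 * (\<integral>t. (cmod (f t - b t))\<^sup>2 \<partial>lborel) + 2 * (\<integral>t. (cmod (b t - g t))\<^sup>2 \<partial>lborel)"
    using 1 by simp
  also have "\<dots> < \<epsilon>" using fb bg by simp
  finally show ?thesis using that[OF g] by blast
qed

section \<open>Mean square continuity of translations\<close>

lemma translation_continuous_compact:
  fixes g :: "real \<Rightarrow> complex"
  assumes cont: "continuous_on UNIV g" and supp: "\<And>t. \<bar>t\<bar> > K \<Longrightarrow> g t = 0"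
    and bd: "\<And>t. cmod (g t) \<le> M" and X: "X \<longlonglongrightarrow> 0"
  shows "(\<lambda>n. \<integral>t. (cmod (g (X n + t) - g t))\<^sup>2 \<partial>lborel) \<longlonglongrightarrow> 0"
proof -
  have [measurable]: "g \<in> borel_measurable borel"
    using cont by (rule borel_measurable_continuous_onI)
  obtain B where B: "\<And>n. \<bar>X n\<bar> \<le> B"
    using convergent_imp_Bseq[OF convergentI[OF X]] by (metis BseqE real_norm_def)
  have B0: "0 \<le> B" using B[of 0] by linarith
  have "(\<lambda>n. \<integral>t. (cmod (g (X n + t) - g t))\<^sup>2 \<partial>lborel) \<longlonglongrightarrow> (\<integral>t. 0 \<partial>(lborel :: real measure))"
  proof (rule integral_dominated_convergence)
    show "integrable lborel (\<lambda>t. 4 * M\<^sup>2 * indicator {-(K+B)..K+B} t :: real)"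
      by (intro integrable_mult_right integrable_real_indicator) (simp_all add: emeasure_lborel_Icc_eq)
    show "AE t in lborel. (\<lambda>n. (cmod (g (X n + t) - g t))\<^sup>2) \<longlonglongrightarrow> 0"
    proof (rule AE_I2)
      fix t
      have "(\<lambda>n. X n + t) \<longlonglongrightarrow> t"
        using tendsto_add[OF X tendsto_const[of t]] by simp
      then have "(\<lambda>n. g (X n + t)) \<longlonglongrightarrow> g t"
        using cont by (intro isCont_tendsto_compose[of t g]) (simp_all add: continuous_on_eq_continuous_at)
      then have "(\<lambda>n. (cmod (g (X n + t) - g t))\<^sup>2) \<longlonglongrightarrow> (cmod (g t - g t))\<^sup>2"
        by (intro tendsto_intros)
      then show "(\<lambda>n. (cmod (g (X n + t) - g t))\<^sup>2) \<longlonglongrightarrow> 0" by simp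
    qed
    show "AE t in lborel. norm ((cmod (g (X n + t) - g t))\<^sup>2) \<le> 4 * M\<^sup>2 * indicator {-(K+B)..K+B} t" for n
    proof (rule AE_I2)
      fix t
      show "norm ((cmod (g (X n + t) - g t))\<^sup>2) \<le> 4 * M\<^sup>2 * indicator {-(K+B)..K+B} t"
      proof (cases "\<bar>t\<bar> > K + B")
        case True
        then have "\<bar>X n + t\<bar> > K" "\<bar>t\<bar> > K" using B[of n] B0 by linarith+
        then show ?thesis using supp by simp
      next
        case False
        have "(cmod (g (X n + t) - g t))\<^sup>2 \<le> 2 * (cmod (g (X n + t)))\<^sup>2 + 2 * (cmod (g t))\<^sup>2"
          by (rule cmod_diff_squared_le)
        also have "\<dots> \<le> 2 * M\<^sup>2 + 2 * M\<^sup>2"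
          by (intro add_mono mult_left_mono power_mono bd) auto
        finally show ?thesis using False by (auto simp: indicator_def)
      qed
    qed
  qed simp_all
  then show ?thesis by simp
qed

lemma L2_translate:
  fixes f :: "real \<Rightarrow> complex"
  assumes "integrable lborel (\<lambda>t. (cmod (f t))\<^sup>2)"
  shows "integrable lborel (\<lambda>t. (cmod (f (h + t)))\<^sup>2)"
    and "(\<integral>t. (cmod (f (h + t)))\<^sup>2 \<partial>lborel) = (\<integral>t. (cmod (f t))\<^sup>2 \<partial>lborel)"
  using lborel_integrable_real_affine[OF assms, of 1 h]
    lborel_integral_real_affine[of 1 "\<lambda>t. (cmod (f t))\<^sup>2" h] by simp_all

lemma translation_continuous_L2:
  fixes f :: "real \<Rightarrow> complex"
  assumes f[measurable]: "f \<in> borel_measurable borel"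
    and L2: "integrable lborel (\<lambda>t. (cmod (f t))\<^sup>2)" and X: "X \<longlonglongrightarrow> 0"
  shows "(\<lambda>n. \<integral>t. (cmod (f (X n + t) - f t))\<^sup>2 \<partial>lborel) \<longlonglongrightarrow> 0"
proof (rule tendstoI)
  fix e :: real assume e: "e > 0"
  \<comment> \<open>The tolerances \<open>e / 12\<close> here and \<open>e / 8\<close> below match the coefficients 6 and 4 of the estimate \<open>D\<close>.\<close>
  then have e12: "e / 12 > 0" by simp
  obtain g K M where cont: "continuous_on UNIV g" and gK: "\<And>t. \<bar>t\<bar> > K \<Longrightarrow> g t = 0"
    and gM: "\<And>t. cmod (g t) \<le> M" and fg: "(\<integral>t. (cmod (f t - g t))\<^sup>2 \<partial>lborel) < e / 12"
    using L2_compact_dense[OF f L2 e12] by metis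
  have g_meas[measurable]: "g \<in> borel_measurable borel"
    using cont by (rule borel_measurable_continuous_onI)
  have L2g: "integrable lborel (\<lambda>t. (cmod (g t))\<^sup>2)"
    using gK gM by (intro L2_of_bounded_support[of g K M]) auto
  have L2d: "integrable lborel (\<lambda>t. (cmod (f t - g t))\<^sup>2)"
    using L2 L2g by (intro L2_diff) auto
  let ?D = "\<lambda>f h. \<integral>t. (cmod (f (h + t) - f t))\<^sup>2 \<partial>lborel"
  \<comment> \<open>A translate of \<open>f\<close> is compared with \<open>f\<close> by way of the same translate of \<open>g\<close> and of \<open>g\<close> itself.\<close>
  have D: "?D f h \<le> 6 * (\<integral>t. (cmod (f t - g t))\<^sup>2 \<partial>lborel) + 4 * ?D g h" for h
  proof -
    have Dg: "integrable lborel (\<lambda>t. (cmod (g (h + t) - g t))\<^sup>2)"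
      using L2g by (intro L2_diff L2_translate) auto
    have Df: "integrable lborel (\<lambda>t. (cmod (f (h + t) - f t))\<^sup>2)"
      using L2 by (intro L2_diff L2_translate) auto
    note T = L2_translate[OF L2d, of h]
    have pt: "(cmod (f (h + t) - f t))\<^sup>2 \<le> 4 * (cmod (f (h + t) - g (h + t)))\<^sup>2
      + 2 * (cmod (f t - g t))\<^sup>2 + 4 * (cmod (g (h + t) - g t))\<^sup>2" for t
    proof -
      have "(cmod (f (h + t) - f t))\<^sup>2 = (cmod (((f (h + t) - g (h + t)) + (g (h + t) - g t)) - (f t - g t)))\<^sup>2"
        by simp
      also have "\<dots> \<le> 2 * (cmod ((f (h + t) - g (h + t)) + (g (h + t) - g t)))\<^sup>2 + 2 * (cmod (f t - g t))\<^sup>2"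
        by (rule cmod_diff_squared_le)
      finally show ?thesis
        using cmod_add_squared_le[of "f (h + t) - g (h + t)" "g (h + t) - g t"] by linarith
    qed
    have "?D f h \<le> (\<integral>t. 4 * (cmod (f (h + t) - g (h + t)))\<^sup>2
      + 2 * (cmod (f t - g t))\<^sup>2 + 4 * (cmod (g (h + t) - g t))\<^sup>2 \<partial>lborel)"
      by (intro integral_mono pt Df Dg L2d T(1) Bochner_Integration.integrable_add integrable_mult_right)
    also have "\<dots> = 6 * (\<integral>t. (cmod (f t - g t))\<^sup>2 \<partial>lborel) + 4 * ?D g h"
      using Dg L2d T by simp
    finally show ?thesis .
  qed
  have "\<forall>\<^sub>F n in sequentially. ?D g (X n) < e / 8"
    using translation_continuous_compact[OF cont gK gM X] e by (intro order_tendstoD(2)) auto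
  then show "\<forall>\<^sub>F n in sequentially. dist (?D f (X n)) 0 < e"
  proof eventually_elim
    case (elim n)
    have "0 \<le> ?D f (X n)" by simp
    then show ?case using D[of "X n"] elim fg by (simp add: dist_real_def)
  qed
qed

section \<open>The Fourier transform and Gaussian damping\<close>

text \<open>
  The Fourier transform with kernel \<open>exp (i t \<xi>)\<close> and no normalising factor. It is the Bochner
  integral, hence meaningful for integrable \<open>f\<close> and 0 where the integral diverges.
\<close>
definition fourier :: "(real \<Rightarrow> complex) \<Rightarrow> real \<Rightarrow> complex" where
  "fourier f \<xi> = (\<integral>t. f t * cis (t * \<xi>) \<partial>lborel)"

lemma borel_measurable_cis [measurable]: "cis \<in> borel_measurable borel"
  by (intro borel_measurable_continuous_onI continuous_intros)

lemma borel_measurable_fourier [measurable (raw)]: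
  assumes [measurable]: "f \<in> borel_measurable borel" "g \<in> borel_measurable M"
  shows "(\<lambda>x. fourier f (g x)) \<in> borel_measurable M"
  unfolding fourier_def by measurable

lemma integrable_mult_cis:
  assumes "integrable lborel f"
  shows "integrable lborel (\<lambda>t. f t * cis (t * \<xi>))"
proof (rule Bochner_Integration.integrable_bound[OF assms])
  have [measurable]: "f \<in> borel_measurable borel" using assms by simp
  show "(\<lambda>t. f t * cis (t * \<xi>)) \<in> borel_measurable lborel" by measurable
qed (simp add: norm_mult)

lemma cmod_fourier_le:
  "integrable lborel f \<Longrightarrow> cmod (fourier f \<xi>) \<le> (\<integral>t. cmod (f t) \<partial>lborel)"
  unfolding fourier_def using integral_norm_bound[of lborel "\<lambda>t. f t * cis (t * \<xi>)"]
  by (simp add: norm_mult)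

text \<open>The damping factor \<open>exp (- \<xi>\<^sup>2 / (2 a\<^sup>2))\<close>, which increases to 1 as \<open>a > 0\<close> grows.\<close>
definition gauss :: "real \<Rightarrow> real \<Rightarrow> real" where
  "gauss a \<xi> = exp (- (\<xi> / a)\<^sup>2 / 2)"

lemma gauss_pos: "0 < gauss a \<xi>" by (simp add: gauss_def)

lemma borel_measurable_cnj [measurable]: "cnj \<in> borel_measurable borel"
  by (intro borel_measurable_continuous_onI continuous_intros)

lemma borel_measurable_gauss [measurable (raw)]:
  assumes [measurable]: "g \<in> borel_measurable M"
  shows "(\<lambda>x. gauss a (g x)) \<in> borel_measurable M"
  unfolding gauss_def by measurable

lemma gauss_eq: "gauss a \<xi> = sqrt (2 * pi) * std_normal_density (\<xi> / a)"
  by (simp add: gauss_def std_normal_density_def)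

lemma integrable_gauss:
  assumes "a > 0" shows "integrable lborel (gauss a)"
proof -
  have "integrable lborel (\<lambda>\<xi>. std_normal_density (0 + (1 / a) * \<xi>))"
    by (rule lborel_integrable_real_affine) (use assms in auto)
  then show ?thesis unfolding gauss_eq[abs_def] by simp
qed

lemma fourier_gauss:
  assumes a: "a > 0"
  shows "fourier (\<lambda>\<xi>. of_real (gauss a \<xi>)) y = of_real (2 * pi * a * std_normal_density (a * y))"
proof -
  have "fourier (\<lambda>\<xi>. of_real (gauss a \<xi>)) y
      = a *\<^sub>R (\<integral>\<xi>. of_real (gauss a (0 + a * \<xi>)) * cis ((0 + a * \<xi>) * y) \<partial>lborel)"
    unfolding fourier_def using a by (subst lborel_integral_real_affine[of a _ 0]) auto
  also have "(\<integral>\<xi>. of_real (gauss a (0 + a * \<xi>)) * cis ((0 + a * \<xi>) * y) \<partial>lborel)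
      = (\<integral>\<xi>. of_real (sqrt (2 * pi)) * (std_normal_density \<xi> *\<^sub>R iexp ((a * y) * \<xi>)) \<partial>lborel)"
    using a by (intro Bochner_Integration.integral_cong)
      (auto simp: gauss_eq cis_conv_exp scaleR_conv_of_real mult_ac)
  also have "\<dots> = of_real (sqrt (2 * pi)) * (\<integral>\<xi>. std_normal_density \<xi> *\<^sub>R iexp ((a * y) * \<xi>) \<partial>lborel)"
    by (rule integral_mult_right_zero)
  also have "\<dots> = of_real (sqrt (2 * pi)) * char std_normal_distribution (a * y)"
    unfolding char_def by (subst integral_density) auto
  also have "\<dots> = of_real (2 * pi * std_normal_density (a * y))"
  proof -
    have "sqrt (2 * pi) * exp (- (a * y)\<^sup>2 / 2) = 2 * pi / sqrt (2 * pi) * exp (- (a * y)\<^sup>2 / 2)"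
      by (simp add: real_div_sqrt)
    then show ?thesis
      unfolding char_std_normal_distribution unfolding std_normal_density_def of_real_mult[symmetric] of_real_eq_iff
      by simp
  qed
  finally show ?thesis by (simp add: scaleR_conv_of_real mult_ac)
qed

lemma integrable_lborel_product:
  fixes f g :: "real \<Rightarrow> complex"
  assumes f: "integrable lborel f" and g: "integrable lborel g"
  shows "integrable (lborel \<Otimes>\<^sub>M lborel) (\<lambda>(x, y). f x * g y)"
proof -
  have [measurable]: "f \<in> borel_measurable borel" "g \<in> borel_measurable borel" using f g by auto
  show ?thesis
  proof (rule lborel_pair.Fubini_integrable)
    show "integrable lborel (\<lambda>x. \<integral>y. norm (case (x, y) of (x, y) \<Rightarrow> f x * g y) \<partial>lborel)"
      using f by (simp add: norm_mult)
    show "AE x in lborel. integrable lborel (\<lambda>y. case (x, y) of (x, y) \<Rightarrow> f x * g y)"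
      using g by simp
  qed measurable
qed

text \<open>
  Fubini's theorem moves the integral over \<open>\<xi>\<close> inside, where it is the Fourier transform of the
  Gaussian. The substitution \<open>t = s - z / a\<close> then leaves the standard normal average of the
  autocorrelation of \<open>f\<close>.
\<close>
lemma damped_autocorrelation:
  fixes f :: "real \<Rightarrow> complex"
  assumes L1: "integrable lborel f" and L2: "integrable lborel (\<lambda>t. (cmod (f t))\<^sup>2)" and a: "a > 0"
  shows "(\<integral>\<xi>. fourier f \<xi> * cnj (fourier f \<xi>) * of_real (gauss a \<xi>) \<partial>lborel)
    = 2 * pi * (\<integral>z. of_real (std_normal_density z) * (\<integral>s. f s * cnj (f (s - z / a)) \<partial>lborel) \<partial>lborel)"
proof -
  have f[measurable]: "f \<in> borel_measurable borel" using L1 by simp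
  have L1': "integrable lborel (\<lambda>t. cnj (f t))" using L1 by simp
  let ?g = "\<lambda>\<xi>. complex_of_real (gauss a \<xi>)"
  define B where "B = (\<integral>t. cmod (f t) \<partial>lborel)"
  have g: "integrable lborel ?g" using integrable_gauss[OF a] by simp
  \<comment> \<open>The three uses of Fubini's theorem. For the first, the transform is bounded by \<open>B\<close>; for the
    last, the estimate \<open>|u v| \<le> |u|\<^sup>2 + |v|\<^sup>2\<close> needs only square integrability.\<close>
  have 1: "integrable (lborel \<Otimes>\<^sub>M lborel) (\<lambda>(s, \<xi>). f s * (cis (s * \<xi>) * cnj (fourier f \<xi>) * ?g \<xi>))"
  proof (rule Bochner_Integration.integrable_bound)
    show "integrable (lborel \<Otimes>\<^sub>M lborel) (\<lambda>(s, \<xi>). f s * (of_real B * ?g \<xi>))"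
      using L1 g by (intro integrable_lborel_product) simp_all
    have "cmod (f s * (cis (s * \<xi>) * cnj (fourier f \<xi>) * ?g \<xi>)) \<le> cmod (f s * (of_real B * ?g \<xi>))" for s \<xi>
      using cmod_fourier_le[OF L1, of \<xi>] gauss_pos[of a \<xi>] unfolding B_def[symmetric]
      by (simp add: norm_mult) (intro mult_left_mono mult_right_mono; simp)
    then show "AE x in lborel \<Otimes>\<^sub>M lborel. norm (case x of (s, \<xi>) \<Rightarrow> f s * (cis (s * \<xi>) * cnj (fourier f \<xi>) * ?g \<xi>))
       \<le> norm (case x of (s, \<xi>) \<Rightarrow> f s * (of_real B * ?g \<xi>))"
      by (intro AE_I2) auto
  qed measurable
  have 2: "integrable (lborel \<Otimes>\<^sub>M lborel) (\<lambda>(t, \<xi>). cnj (f t) * (?g \<xi> * cis (\<xi> * (s - t))))" for s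
  proof (rule Bochner_Integration.integrable_bound)
    show "integrable (lborel \<Otimes>\<^sub>M lborel) (\<lambda>(s, \<xi>). cnj (f s) * ?g \<xi>)"
      using L1' g by (intro integrable_lborel_product) simp_all
    show "AE x in lborel \<Otimes>\<^sub>M lborel. norm (case x of (t, \<xi>) \<Rightarrow> cnj (f t) * (?g \<xi> * cis (\<xi> * (s - t))))
       \<le> norm (case x of (t, \<xi>) \<Rightarrow> cnj (f t) * ?g \<xi>)"
      by (intro AE_I2) (auto simp: norm_mult)
  qed measurable
  have inner: "(\<integral>\<xi>. cis (s * \<xi>) * cnj (fourier f \<xi>) * ?g \<xi> \<partial>lborel)
      = 2 * pi * (\<integral>z. cnj (f (s - z / a)) * of_real (std_normal_density z) \<partial>lborel)" for s
  proof -
    have "(\<integral>\<xi>. cis (s * \<xi>) * cnj (fourier f \<xi>) * ?g \<xi> \<partial>lborel)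
      = (\<integral>\<xi>. (\<integral>t. cnj (f t) * (?g \<xi> * cis (\<xi> * (s - t))) \<partial>lborel) \<partial>lborel)"
    proof (rule Bochner_Integration.integral_cong[OF refl])
      fix \<xi>
      have "cis (s * \<xi>) * cnj (fourier f \<xi>) * ?g \<xi>
        = (\<integral>t. cnj (f t * cis (t * \<xi>)) \<partial>lborel) * (cis (s * \<xi>) * ?g \<xi>)"
        unfolding Bochner_Integration.integral_cnj fourier_def by (simp only: mult_ac)
      also have "\<dots> = (\<integral>t. cnj (f t * cis (t * \<xi>)) * (cis (s * \<xi>) * ?g \<xi>) \<partial>lborel)"
        by (rule integral_mult_left_zero[symmetric])
      also have "\<dots> = (\<integral>t. cnj (f t) * (?g \<xi> * cis (\<xi> * (s - t))) \<partial>lborel)"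
      proof (rule Bochner_Integration.integral_cong[OF refl])
        fix t
        have "cis (\<xi> * (s - t)) = cis (s * \<xi>) * cis (- (t * \<xi>))"
          by (simp add: cis_mult algebra_simps)
        then show "cnj (f t * cis (t * \<xi>)) * (cis (s * \<xi>) * ?g \<xi>) = cnj (f t) * (?g \<xi> * cis (\<xi> * (s - t)))"
          by (simp add: cis_cnj mult_ac)
      qed
      finally show "cis (s * \<xi>) * cnj (fourier f \<xi>) * ?g \<xi>
        = (\<integral>t. cnj (f t) * (?g \<xi> * cis (\<xi> * (s - t))) \<partial>lborel)" .
    qed
    also have "\<dots> = (\<integral>t. (\<integral>\<xi>. cnj (f t) * (?g \<xi> * cis (\<xi> * (s - t))) \<partial>lborel) \<partial>lborel)"
      by (rule lborel_pair.Fubini_integral[OF 2])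
    also have "\<dots> = (\<integral>t. cnj (f t) * of_real (2 * pi * a * std_normal_density (a * (s - t))) \<partial>lborel)"
      by (simp add: fourier_gauss[OF a, unfolded fourier_def])
    also have "\<dots> = \<bar>- 1 / a\<bar> *\<^sub>R (\<integral>z. cnj (f (s + (- 1 / a) * z)) *
        of_real (2 * pi * a * std_normal_density (a * (s - (s + (- 1 / a) * z)))) \<partial>lborel)"
      using a by (intro lborel_integral_real_affine) auto
    also have "\<dots> = \<bar>- 1 / a\<bar> *\<^sub>R (\<integral>z. (2 * pi * a) * (cnj (f (s - z / a)) * of_real (std_normal_density z)) \<partial>lborel)"
      using a by (intro arg_cong2[where f=scaleR] refl Bochner_Integration.integral_cong) (auto simp: mult_ac)
    also have "\<dots> = 2 * pi * (\<integral>z. cnj (f (s - z / a)) * of_real (std_normal_density z) \<partial>lborel)"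
      using a by (simp add: scaleR_conv_of_real)
    finally show ?thesis .
  qed
  have 3: "integrable (lborel \<Otimes>\<^sub>M lborel) (\<lambda>(z, s). f s * (cnj (f (s - z / a)) * of_real (std_normal_density z)))"
  proof (rule Bochner_Integration.integrable_bound)
    let ?h = "\<lambda>(z, s). ((cmod (f s))\<^sup>2 + (cmod (f (- z / a + s)))\<^sup>2) * std_normal_density z"
    have I: "integrable lborel (\<lambda>s. (cmod (f s))\<^sup>2 + (cmod (f (- z / a + s)))\<^sup>2)" for z
      by (intro Bochner_Integration.integrable_add L2 L2_translate)
    have E: "(\<integral>s. (cmod (f s))\<^sup>2 + (cmod (f (- z / a + s)))\<^sup>2 \<partial>lborel) = 2 * (\<integral>s. (cmod (f s))\<^sup>2 \<partial>lborel)" for z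
      using L2_translate[OF L2, of "- z / a"] L2 by simp
    show "integrable (lborel \<Otimes>\<^sub>M lborel) ?h"
    proof (rule lborel_pair.Fubini_integrable)
      show "integrable lborel (\<lambda>z. \<integral>s. norm (?h (z, s)) \<partial>lborel)"
        using E by (simp add: abs_mult)
      show "AE z in lborel. integrable lborel (\<lambda>s. ?h (z, s))"
        using I by simp
    qed measurable
    have "cmod (f s * (cnj (f (s - z / a)) * of_real (std_normal_density z))) \<le> norm (?h (z, s))" for z s
    proof -
      have "cmod (f s) * cmod (f (s - z / a)) \<le> (cmod (f s))\<^sup>2 + (cmod (f (s - z / a)))\<^sup>2"
        by (rule cmod_mult_le_sum_squares)
      then show ?thesis
        using mult_right_mono[OF _ normal_density_nonneg[of 0 1 z],
            of "cmod (f s) * cmod (f (s - z / a))" "(cmod (f s))\<^sup>2 + (cmod (f (s - z / a)))\<^sup>2"]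
        by (simp add: norm_mult abs_mult mult_ac)
    qed
    then show "AE x in lborel \<Otimes>\<^sub>M lborel. norm (case x of (z, s) \<Rightarrow> f s * (cnj (f (s - z / a)) * of_real (std_normal_density z)))
       \<le> norm (?h x)"
      by (intro AE_I2) auto
  qed measurable
  have "(\<integral>\<xi>. fourier f \<xi> * cnj (fourier f \<xi>) * ?g \<xi> \<partial>lborel)
    = (\<integral>\<xi>. (\<integral>s. f s * (cis (s * \<xi>) * cnj (fourier f \<xi>) * ?g \<xi>) \<partial>lborel) \<partial>lborel)"
  proof (rule Bochner_Integration.integral_cong[OF refl])
    fix \<xi>
    have "(\<integral>s. f s * (cis (s * \<xi>) * cnj (fourier f \<xi>) * ?g \<xi>) \<partial>lborel)
      = (\<integral>s. (f s * cis (s * \<xi>)) * (cnj (fourier f \<xi>) * ?g \<xi>) \<partial>lborel)"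
      by (simp add: mult_ac)
    also have "\<dots> = fourier f \<xi> * (cnj (fourier f \<xi>) * ?g \<xi>)"
      unfolding fourier_def by (rule integral_mult_left_zero)
    finally show "fourier f \<xi> * cnj (fourier f \<xi>) * ?g \<xi>
      = (\<integral>s. f s * (cis (s * \<xi>) * cnj (fourier f \<xi>) * ?g \<xi>) \<partial>lborel)" by (simp add: mult_ac)
  qed
  also have "\<dots> = (\<integral>s. (\<integral>\<xi>. f s * (cis (s * \<xi>) * cnj (fourier f \<xi>) * ?g \<xi>) \<partial>lborel) \<partial>lborel)"
    by (rule lborel_pair.Fubini_integral[OF 1])
  also have "\<dots> = (\<integral>s. 2 * pi * (\<integral>z. f s * (cnj (f (s - z / a)) * of_real (std_normal_density z)) \<partial>lborel) \<partial>lborel)"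
  proof (rule Bochner_Integration.integral_cong[OF refl])
    show "(\<integral>\<xi>. f s * (cis (s * \<xi>) * cnj (fourier f \<xi>) * ?g \<xi>) \<partial>lborel)
      = 2 * pi * (\<integral>z. f s * (cnj (f (s - z / a)) * of_real (std_normal_density z)) \<partial>lborel)" for s
      unfolding integral_mult_right_zero inner by (simp only: mult_ac)
  qed
  also have "\<dots> = 2 * pi * (\<integral>s. (\<integral>z. f s * (cnj (f (s - z / a)) * of_real (std_normal_density z)) \<partial>lborel) \<partial>lborel)"
    by simp
  also have "(\<integral>s. (\<integral>z. f s * (cnj (f (s - z / a)) * of_real (std_normal_density z)) \<partial>lborel) \<partial>lborel)
     = (\<integral>z. (\<integral>s. f s * (cnj (f (s - z / a)) * of_real (std_normal_density z)) \<partial>lborel) \<partial>lborel)"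
    by (rule lborel_pair.Fubini_integral[OF 3])
  also have "\<dots> = (\<integral>z. of_real (std_normal_density z) * (\<integral>s. f s * cnj (f (s - z / a)) \<partial>lborel) \<partial>lborel)"
    by (simp flip: integral_mult_right_zero add: mult_ac)
  finally show ?thesis .
qed

section \<open>Plancherel and Parseval for functions that are integrable and square integrable\<close>

lemma Re_mult_cnj_polar: "Re (a * cnj b) = ((cmod a)\<^sup>2 + (cmod b)\<^sup>2 - (cmod (b - a))\<^sup>2) / 2"
  by (simp add: cmod_power2 field_simps) (simp add: power2_eq_square algebra_simps)

lemma Re_of_real_mult: "Re (of_real r * z) = r * Re z"
  by simp

text \<open>
  The left-hand side being real, only the real part of the autocorrelation matters, and at lag \<open>h\<close>
  this is the energy of \<open>f\<close> minus half the squared distance of \<open>f\<close> from its translate by \<open>h\<close>.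
\<close>
lemma damped_Plancherel:
  fixes f :: "real \<Rightarrow> complex"
  assumes L1: "integrable lborel f" and L2: "integrable lborel (\<lambda>t. (cmod (f t))\<^sup>2)" and a: "a > 0"
  shows "integrable lborel (\<lambda>\<xi>. (cmod (fourier f \<xi>))\<^sup>2 * gauss a \<xi>)"
    and "(\<integral>\<xi>. (cmod (fourier f \<xi>))\<^sup>2 * gauss a \<xi> \<partial>lborel)
    = 2 * pi * (\<integral>z. std_normal_density z * ((\<integral>t. (cmod (f t))\<^sup>2 \<partial>lborel)
        - (\<integral>t. (cmod (f (- z / a + t) - f t))\<^sup>2 \<partial>lborel) / 2) \<partial>lborel)"
proof -
  have f[measurable]: "f \<in> borel_measurable borel" using L1 by simp
  define B where "B = (\<integral>t. cmod (f t) \<partial>lborel)"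
  show I: "integrable lborel (\<lambda>\<xi>. (cmod (fourier f \<xi>))\<^sup>2 * gauss a \<xi>)"
  proof (rule Bochner_Integration.integrable_bound)
    show "integrable lborel (\<lambda>\<xi>. B\<^sup>2 * gauss a \<xi>)"
      using integrable_gauss[OF a] by simp
    have "(cmod (fourier f \<xi>))\<^sup>2 \<le> B\<^sup>2" for \<xi>
      using cmod_fourier_le[OF L1, of \<xi>] unfolding B_def by (intro power_mono) auto
    then show "AE \<xi> in lborel. norm ((cmod (fourier f \<xi>))\<^sup>2 * gauss a \<xi>) \<le> norm (B\<^sup>2 * gauss a \<xi>)"
      by (intro AE_I2) (simp add: abs_mult mult_right_mono)
  qed measurable
  have R: "Re (\<integral>s. f s * cnj (f (s - z / a)) \<partial>lborel)
      = (\<integral>t. (cmod (f t))\<^sup>2 \<partial>lborel) - (\<integral>t. (cmod (f (- z / a + t) - f t))\<^sup>2 \<partial>lborel) / 2" for z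
  proof -
    note T = L2_translate[OF L2, of "- z / a"]
    have D: "integrable lborel (\<lambda>t. (cmod (f (- z / a + t) - f t))\<^sup>2)"
      using L2 T(1) by (intro L2_diff) auto
    have "integrable lborel (\<lambda>s. f s * cnj (f (- z / a + s)))"
      using L2 T(1) by (intro integrable_mult_of_L2) auto
    then have "Re (\<integral>s. f s * cnj (f (- z / a + s)) \<partial>lborel) = (\<integral>s. Re (f s * cnj (f (- z / a + s))) \<partial>lborel)"
      by (rule integral_Re[symmetric])
    also have "\<dots> = (\<integral>s. ((cmod (f s))\<^sup>2 + (cmod (f (- z / a + s)))\<^sup>2 - (cmod (f (- z / a + s) - f s))\<^sup>2) / 2 \<partial>lborel)"
      by (simp only: Re_mult_cnj_polar)
    also have "\<dots> = (\<integral>t. (cmod (f t))\<^sup>2 \<partial>lborel) - (\<integral>t. (cmod (f (- z / a + t) - f t))\<^sup>2 \<partial>lborel) / 2"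
      using T D L2 by simp
    finally show ?thesis by simp
  qed
  let ?c = "\<lambda>z. of_real (std_normal_density z) * (\<integral>s. f s * cnj (f (s - z / a)) \<partial>lborel)"
  have c: "integrable lborel ?c"
  proof (rule Bochner_Integration.integrable_bound)
    show "integrable lborel (\<lambda>z. std_normal_density z * (2 * (\<integral>t. (cmod (f t))\<^sup>2 \<partial>lborel)))"
      by simp
    have "cmod (\<integral>s. f s * cnj (f (s - z / a)) \<partial>lborel) \<le> 2 * (\<integral>t. (cmod (f t))\<^sup>2 \<partial>lborel)" for z
    proof -
      note T = L2_translate[OF L2, of "- z / a"]
      have "cmod (\<integral>s. f s * cnj (f (- z / a + s)) \<partial>lborel)
        \<le> (\<integral>s. (cmod (f s))\<^sup>2 + (cmod (f (- z / a + s)))\<^sup>2 \<partial>lborel)"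
      proof (rule order_trans[OF integral_norm_bound], rule Bochner_Integration.integral_mono)
        show "integrable lborel (\<lambda>s. norm (f s * cnj (f (- z / a + s))))"
          using L2 T(1) by (intro integrable_norm integrable_mult_of_L2) auto
        show "norm (f s * cnj (f (- z / a + s))) \<le> (cmod (f s))\<^sup>2 + (cmod (f (- z / a + s)))\<^sup>2" for s
          unfolding norm_mult complex_mod_cnj by (rule cmod_mult_le_sum_squares)
      qed (use T(1) L2 in auto)
      also have "\<dots> = 2 * (\<integral>t. (cmod (f t))\<^sup>2 \<partial>lborel)"
        using T L2 by simp
      finally show ?thesis by simp
    qed
    then show "AE z in lborel. norm (?c z) \<le> norm (std_normal_density z * (2 * (\<integral>t. (cmod (f t))\<^sup>2 \<partial>lborel)))"
      by (intro AE_I2) (simp add: norm_mult abs_mult mult_left_mono)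
  qed measurable
  have "(\<integral>\<xi>. (cmod (fourier f \<xi>))\<^sup>2 * gauss a \<xi> \<partial>lborel)
    = Re (\<integral>\<xi>. of_real ((cmod (fourier f \<xi>))\<^sup>2 * gauss a \<xi>) \<partial>lborel)"
    by (subst integral_complex_of_real) simp
  also have "\<dots> = Re (\<integral>\<xi>. fourier f \<xi> * cnj (fourier f \<xi>) * of_real (gauss a \<xi>) \<partial>lborel)"
    by (intro arg_cong[where f = Re] Bochner_Integration.integral_cong refl)
      (simp add: complex_norm_square[symmetric] flip: of_real_power)
  also have "\<dots> = 2 * pi * Re (\<integral>z. ?c z \<partial>lborel)"
    unfolding damped_autocorrelation[OF L1 L2 a] by simp
  also have "Re (\<integral>z. ?c z \<partial>lborel) = (\<integral>z. Re (?c z) \<partial>lborel)"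
    by (rule integral_Re[OF c, symmetric])
  also have "\<dots> = (\<integral>z. std_normal_density z * ((\<integral>t. (cmod (f t))\<^sup>2 \<partial>lborel)
        - (\<integral>t. (cmod (f (- z / a + t) - f t))\<^sup>2 \<partial>lborel) / 2) \<partial>lborel)"
    by (intro Bochner_Integration.integral_cong refl) (simp only: R Re_of_real_mult)
  finally show "(\<integral>\<xi>. (cmod (fourier f \<xi>))\<^sup>2 * gauss a \<xi> \<partial>lborel)
    = 2 * pi * (\<integral>z. std_normal_density z * ((\<integral>t. (cmod (f t))\<^sup>2 \<partial>lborel)
        - (\<integral>t. (cmod (f (- z / a + t) - f t))\<^sup>2 \<partial>lborel) / 2) \<partial>lborel)" .
qed

text \<open>
  As the damping is removed, the left-hand side of \<open>damped_Plancherel\<close> converges by monotone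
  convergence, and the right-hand side by dominated convergence and continuity of translations.
\<close>
lemma Plancherel_L1_L2:
  fixes f :: "real \<Rightarrow> complex"
  assumes L1: "integrable lborel f" and L2: "integrable lborel (\<lambda>t. (cmod (f t))\<^sup>2)"
  shows "integrable lborel (\<lambda>\<xi>. (cmod (fourier f \<xi>))\<^sup>2)"
    and "(\<integral>\<xi>. (cmod (fourier f \<xi>))\<^sup>2 \<partial>lborel) = 2 * pi * (\<integral>t. (cmod (f t))\<^sup>2 \<partial>lborel)"
proof -
  have f[measurable]: "f \<in> borel_measurable borel" using L1 by simp
  let ?E = "\<integral>t. (cmod (f t))\<^sup>2 \<partial>lborel"
  let ?D = "\<lambda>h. \<integral>t. (cmod (f (h + t) - f t))\<^sup>2 \<partial>lborel"
  \<comment> \<open>The widths \<open>a = n + 1\<close> are positive for every \<open>n\<close>.\<close>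
  let ?F = "\<lambda>n \<xi>. (cmod (fourier f \<xi>))\<^sup>2 * gauss (real (Suc n)) \<xi>"
  have "(\<lambda>n. \<integral>z. std_normal_density z * (?E - ?D (- z / real (Suc n)) / 2) \<partial>lborel)
    \<longlonglongrightarrow> (\<integral>z. std_normal_density z * ?E \<partial>lborel)"
  proof (rule integral_dominated_convergence)
    show "integrable lborel (\<lambda>z. std_normal_density z * (3 * ?E))" by simp
    show "AE z in lborel. (\<lambda>n. std_normal_density z * (?E - ?D (- z / real (Suc n)) / 2))
      \<longlonglongrightarrow> std_normal_density z * ?E"
    proof (rule AE_I2)
      fix z
      have "(\<lambda>n. - z / real (Suc n)) \<longlonglongrightarrow> 0"
        by (rule LIMSEQ_Suc[OF lim_const_over_n])
      then have "(\<lambda>n. ?D (- z / real (Suc n))) \<longlonglongrightarrow> 0"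
        by (rule translation_continuous_L2[OF f L2])
      then have "(\<lambda>n. std_normal_density z * (?E - ?D (- z / real (Suc n)) / 2))
        \<longlonglongrightarrow> std_normal_density z * (?E - 0 / 2)"
        by (intro tendsto_intros) auto
      then show "(\<lambda>n. std_normal_density z * (?E - ?D (- z / real (Suc n)) / 2))
        \<longlonglongrightarrow> std_normal_density z * ?E" by simp
    qed
    have D4: "?D h \<le> 4 * ?E" for h
    proof -
      note T = L2_translate[OF L2, of h]
      have "?D h \<le> (\<integral>t. 2 * (cmod (f (h + t)))\<^sup>2 + 2 * (cmod (f t))\<^sup>2 \<partial>lborel)"
        using T(1) L2 by (intro integral_mono cmod_diff_squared_le L2_diff) auto
      also have "\<dots> = 4 * ?E" using T L2 by simp
      finally show ?thesis .
    qed
    have "\<bar>?E - ?D h / 2\<bar> \<le> 3 * ?E" for h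
    proof -
      have "0 \<le> ?D h" "0 \<le> ?E" by simp_all
      then show ?thesis using D4[of h] by linarith
    qed
    then show "AE z in lborel. norm (std_normal_density z * (?E - ?D (- z / real (Suc n)) / 2))
      \<le> std_normal_density z * (3 * ?E)" for n
      by (intro AE_I2) (simp only: real_norm_def abs_mult abs_of_nonneg[OF normal_density_nonneg]
          mult_left_mono[OF _ normal_density_nonneg])
  qed measurable
  then have "(\<lambda>n. 2 * pi * (\<integral>z. std_normal_density z * (?E - ?D (- z / real (Suc n)) / 2) \<partial>lborel))
    \<longlonglongrightarrow> 2 * pi * ?E"
    by (intro tendsto_intros) simp
  then have lim: "(\<lambda>n. \<integral>\<xi>. ?F n \<xi> \<partial>lborel) \<longlonglongrightarrow> 2 * pi * ?E"
    using damped_Plancherel(2)[OF L1 L2] by simp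
  have mono: "AE \<xi> in lborel. mono (\<lambda>n. ?F n \<xi>)"
  proof (intro AE_I2 monoI)
    fix \<xi> :: real and m n :: nat assume "m \<le> n"
    then have "\<bar>\<xi> / real (Suc n)\<bar> \<le> \<bar>\<xi> / real (Suc m)\<bar>"
      unfolding abs_divide by (intro divide_left_mono) auto
    then have "(\<xi> / real (Suc n))\<^sup>2 \<le> (\<xi> / real (Suc m))\<^sup>2"
      by (simp only: abs_le_square_iff)
    then show "?F m \<xi> \<le> ?F n \<xi>"
      unfolding gauss_def by (intro mult_left_mono) auto
  qed
  have conv: "AE \<xi> in lborel. (\<lambda>n. ?F n \<xi>) \<longlonglongrightarrow> (cmod (fourier f \<xi>))\<^sup>2"
  proof (rule AE_I2)
    fix \<xi>
    have "(\<lambda>n. \<xi> / real (Suc n)) \<longlonglongrightarrow> 0"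
      by (rule LIMSEQ_Suc[OF lim_const_over_n])
    then have "(\<lambda>n. ?F n \<xi>) \<longlonglongrightarrow> (cmod (fourier f \<xi>))\<^sup>2 * exp (- 0\<^sup>2 / 2)"
      unfolding gauss_def by (intro tendsto_intros) auto
    then show "(\<lambda>n. ?F n \<xi>) \<longlonglongrightarrow> (cmod (fourier f \<xi>))\<^sup>2" by simp
  qed
  have meas: "(\<lambda>\<xi>. (cmod (fourier f \<xi>))\<^sup>2) \<in> borel_measurable lborel" by measurable
  have int: "integrable lborel (?F n)" for n
    by (rule damped_Plancherel(1)[OF L1 L2]) simp
  show "integrable lborel (\<lambda>\<xi>. (cmod (fourier f \<xi>))\<^sup>2)"
    by (rule integrable_monotone_convergence[OF int mono conv lim meas])
  show "(\<integral>\<xi>. (cmod (fourier f \<xi>))\<^sup>2 \<partial>lborel) = 2 * pi * ?E"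
    by (rule integral_monotone_convergence[OF int mono conv lim meas])
qed

lemma mult_cnj_polarization:
  "a * cnj b = ((cmod (a + b))\<^sup>2 + \<i> * (cmod (a + \<i> * b))\<^sup>2 - (1 + \<i>) * ((cmod a)\<^sup>2 + (cmod b)\<^sup>2)) / 2"
  by (simp add: complex_eq_iff cmod_power2 field_simps) (simp add: power2_eq_square algebra_simps)

lemma fourier_add:
  "integrable lborel f \<Longrightarrow> integrable lborel g \<Longrightarrow> fourier (\<lambda>t. f t + g t) \<xi> = fourier f \<xi> + fourier g \<xi>"
  unfolding fourier_def by (simp add: distrib_right integrable_mult_cis)

lemma fourier_cmult: "fourier (\<lambda>t. c * f t) \<xi> = c * fourier f \<xi>"
  unfolding fourier_def by (simp add: mult.assoc)

lemma Parseval_L1_L2: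
  fixes f g :: "real \<Rightarrow> complex"
  assumes f1: "integrable lborel f" and f2: "integrable lborel (\<lambda>t. (cmod (f t))\<^sup>2)"
    and g1: "integrable lborel g" and g2: "integrable lborel (\<lambda>t. (cmod (g t))\<^sup>2)"
  shows "(\<integral>\<xi>. fourier f \<xi> * cnj (fourier g \<xi>) \<partial>lborel) = 2 * pi * (\<integral>t. f t * cnj (g t) \<partial>lborel)"
proof -
  have [measurable]: "f \<in> borel_measurable borel" "g \<in> borel_measurable borel" using f1 g1 by auto
  have ig2: "integrable lborel (\<lambda>t. (cmod (\<i> * g t))\<^sup>2)" using g2 by (simp add: norm_mult)
  have ig1: "integrable lborel (\<lambda>t. \<i> * g t)" using g1 by simp
  have s1: "integrable lborel (\<lambda>t. f t + g t)" and s2: "integrable lborel (\<lambda>t. (cmod (f t + g t))\<^sup>2)"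
    using f1 g1 f2 g2 by (auto intro: L2_add)
  have t1: "integrable lborel (\<lambda>t. f t + \<i> * g t)" and t2: "integrable lborel (\<lambda>t. (cmod (f t + \<i> * g t))\<^sup>2)"
    using f1 ig1 f2 ig2 by (auto intro!: L2_add)
  have pol: "(\<integral>t. p t * cnj (q t) \<partial>lborel) = (complex_of_real (\<integral>t. (cmod (p t + q t))\<^sup>2 \<partial>lborel)
      + \<i> * complex_of_real (\<integral>t. (cmod (p t + \<i> * q t))\<^sup>2 \<partial>lborel)
      - (1 + \<i>) * (complex_of_real (\<integral>t. (cmod (p t))\<^sup>2 \<partial>lborel) + complex_of_real (\<integral>t. (cmod (q t))\<^sup>2 \<partial>lborel))) / 2"
    if i: "integrable lborel (\<lambda>t. (cmod (p t + q t))\<^sup>2)" "integrable lborel (\<lambda>t. (cmod (p t + \<i> * q t))\<^sup>2)"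
      "integrable lborel (\<lambda>t. (cmod (p t))\<^sup>2)" "integrable lborel (\<lambda>t. (cmod (q t))\<^sup>2)" for p q :: "real \<Rightarrow> complex"
  proof -
    have c: "integrable lborel (\<lambda>t. complex_of_real ((cmod (p t + q t))\<^sup>2))"
      "integrable lborel (\<lambda>t. complex_of_real ((cmod (p t + \<i> * q t))\<^sup>2))"
      "integrable lborel (\<lambda>t. complex_of_real ((cmod (p t))\<^sup>2))"
      "integrable lborel (\<lambda>t. complex_of_real ((cmod (q t))\<^sup>2))"
      using i[THEN integrable_of_real] by auto
    show ?thesis
      unfolding mult_cnj_polarization[of "p _"] integral_complex_of_real[symmetric]
      using c by (simp del: of_real_power integral_complex_of_real)
  qed
  note P = Plancherel_L1_L2[OF f1 f2] Plancherel_L1_L2[OF g1 g2]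
    Plancherel_L1_L2[OF s1 s2, unfolded fourier_add[OF f1 g1]]
    Plancherel_L1_L2[OF t1 t2, unfolded fourier_add[OF f1 ig1] fourier_cmult]
  show ?thesis
    unfolding pol[OF P(5,7,1,3)] pol[OF s2 t2 f2 g2] P(2,4,6,8) by (simp add: field_simps)
qed

section \<open>Moyal's formula for Borel functions\<close>

text \<open>
  The map \<open>(\<tau>, t) \<mapsto> (t + k \<tau> / 2, t - k \<tau> / 2)\<close> has Jacobian determinant of modulus \<open>k\<close>. It is
  treated as a shear of \<open>t\<close> for fixed \<open>\<tau>\<close> followed by an affine change of \<open>\<tau>\<close> for fixed \<open>t\<close>.
\<close>
lemma integral_sheared_product:
  fixes p q :: "real \<Rightarrow> complex"
  assumes p: "integrable lborel p" and q: "integrable lborel q" and k: "k > 0"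
  shows "integrable (lborel \<Otimes>\<^sub>M lborel) (\<lambda>(\<tau>, t). p (t + k * (\<tau> / 2)) * q (t - k * (\<tau> / 2)))"
    and "(\<integral>\<tau>. (\<integral>t. p (t + k * (\<tau> / 2)) * q (t - k * (\<tau> / 2)) \<partial>lborel) \<partial>lborel)
      = (\<integral>t. p t \<partial>lborel) * (\<integral>t. q t \<partial>lborel) / k"
proof -
  have [measurable]: "p \<in> borel_measurable borel" "q \<in> borel_measurable borel" using p q by auto
  have scale: "(\<integral>\<tau>. f (t + k * \<tau>) \<partial>lborel) = (1 / k) *\<^sub>R (\<integral>\<tau>. f \<tau> \<partial>lborel)"
    for t and f :: "real \<Rightarrow> 'c :: {banach, second_countable_topology}"
    using lborel_integral_real_affine[of k f t] k by simp
  have "integrable (lborel \<Otimes>\<^sub>M lborel) (\<lambda>(t, \<tau>). p (t + k * \<tau>) * q t)"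
  proof (rule lborel_pair.Fubini_integrable)
    show "integrable lborel (\<lambda>t. \<integral>\<tau>. norm (case (t, \<tau>) of (t, \<tau>) \<Rightarrow> p (t + k * \<tau>) * q t) \<partial>lborel)"
      using q scale[of "\<lambda>\<tau>. cmod (p \<tau>)"] by (simp add: norm_mult)
    show "AE t in lborel. integrable lborel (\<lambda>\<tau>. case (t, \<tau>) of (t, \<tau>) \<Rightarrow> p (t + k * \<tau>) * q t)"
      using lborel_integrable_real_affine[OF p, of k] k by simp
  qed measurable
  from lborel_pair.integrable_product_swap[OF this]
  have I2: "integrable (lborel \<Otimes>\<^sub>M lborel) (\<lambda>(\<tau>, t). p (t + k * \<tau>) * q t)"
    by simp
  have centre: "(\<integral>t. f (p (t + k * (\<tau> / 2)) * q (t - k * (\<tau> / 2))) \<partial>lborel) = (\<integral>t. f (p (t + k * \<tau>) * q t) \<partial>lborel)"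
    for \<tau> and f :: "complex \<Rightarrow> 'c :: {banach, second_countable_topology}"
    using lborel_integral_real_affine[of 1 "\<lambda>t. f (p (t + k * (\<tau> / 2)) * q (t - k * (\<tau> / 2)))" "k * (\<tau> / 2)"]
    by (simp add: algebra_simps)
  show "integrable (lborel \<Otimes>\<^sub>M lborel) (\<lambda>(\<tau>, t). p (t + k * (\<tau> / 2)) * q (t - k * (\<tau> / 2)))"
  proof (rule lborel_pair.Fubini_integrable)
    show "integrable lborel (\<lambda>\<tau>. \<integral>t. norm (case (\<tau>, t) of (\<tau>, t) \<Rightarrow>
        p (t + k * (\<tau> / 2)) * q (t - k * (\<tau> / 2))) \<partial>lborel)"
      using lborel_pair.integrable_fst'[OF integrable_norm[OF I2]]
      unfolding prod.case centre[of norm] .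
    show "AE \<tau> in lborel. integrable lborel (\<lambda>t. case (\<tau>, t) of (\<tau>, t) \<Rightarrow>
        p (t + k * (\<tau> / 2)) * q (t - k * (\<tau> / 2)))"
      using lborel_pair.AE_integrable_fst'[OF I2]
    proof eventually_elim
      case (elim \<tau>)
      then have "integrable lborel (\<lambda>t. p (t + k * \<tau>) * q t)" by simp
      from lborel_integrable_real_affine[OF this, of 1 "- (k * (\<tau> / 2))"]
      show ?case by (simp add: algebra_simps)
    qed
  qed measurable
  have "(\<integral>\<tau>. (\<integral>t. p (t + k * (\<tau> / 2)) * q (t - k * (\<tau> / 2)) \<partial>lborel) \<partial>lborel)
    = (\<integral>\<tau>. (\<integral>t. p (t + k * \<tau>) * q t \<partial>lborel) \<partial>lborel)"
    using centre[of "\<lambda>z. z"] by simp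
  also have "\<dots> = (\<integral>t. (\<integral>\<tau>. p (t + k * \<tau>) * q t \<partial>lborel) \<partial>lborel)"
    by (rule lborel_pair.Fubini_integral[OF I2, symmetric])
  also have "\<dots> = (\<integral>t. p t \<partial>lborel) * (\<integral>t. q t \<partial>lborel) / k"
    by (simp add: scale scaleR_conv_of_real)
  finally show "(\<integral>\<tau>. (\<integral>t. p (t + k * (\<tau> / 2)) * q (t - k * (\<tau> / 2)) \<partial>lborel) \<partial>lborel)
      = (\<integral>t. p t \<partial>lborel) * (\<integral>t. q t \<partial>lborel) / k" .
qed

text \<open>
  The function of \<open>t\<close> whose Fourier transform is the ambiguity function at delay \<open>\<tau>\<close>.
\<close>
definition lag_product :: "real \<Rightarrow> (real \<Rightarrow> complex) \<Rightarrow> real \<Rightarrow> real \<Rightarrow> complex" where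
  "lag_product k x \<tau> t = x (t + k * (\<tau> / 2)) * cnj (x (t - k * (\<tau> / 2)))"

text \<open>
  The ambiguity function without its factor \<open>|\<Omega>|\<^sup>2\<close>, for a general affine frequency
  \<open>b \<tau> - c u\<close>; the fractional one has \<open>b = k cot \<theta>\<close> and \<open>c = csc \<theta>\<close>.
\<close>
definition ambiguity :: "real \<Rightarrow> real \<Rightarrow> real \<Rightarrow> (real \<Rightarrow> complex) \<Rightarrow> real \<Rightarrow> real \<Rightarrow> complex" where
  "ambiguity k b c x \<tau> u = fourier (lag_product k x \<tau>) (b * \<tau> - c * u)"

lemma borel_measurable_ambiguity [measurable (raw)]:
  assumes [measurable]: "x \<in> borel_measurable borel" "f \<in> borel_measurable M" "g \<in> borel_measurable M"
  shows "(\<lambda>w. ambiguity k b c x (f w) (g w)) \<in> borel_measurable M"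
  unfolding ambiguity_def fourier_def lag_product_def by measurable

lemma integrable_lag_product:
  assumes [measurable]: "x \<in> borel_measurable borel" and x: "integrable lborel (\<lambda>t. (cmod (x t))\<^sup>2)"
  shows "integrable lborel (lag_product k x \<tau>)"
  unfolding lag_product_def
  using L2_translate(1)[OF x, of "k * (\<tau> / 2)"] L2_translate(1)[OF x, of "- (k * (\<tau> / 2))"]
  by (intro integrable_mult_of_L2) (simp_all add: add.commute)

lemma lag_product_L2:
  assumes [measurable]: "x \<in> borel_measurable borel" and x: "integrable lborel (\<lambda>t. (cmod (x t))\<^sup>2)" and k: "k > 0"
  shows "integrable (lborel \<Otimes>\<^sub>M lborel) (\<lambda>(\<tau>, t). (cmod (lag_product k x \<tau> t))\<^sup>2)"
proof -
  have "integrable lborel (\<lambda>t. complex_of_real ((cmod (x t))\<^sup>2))"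
    using x by (rule integrable_of_real)
  from integrable_norm[OF integral_sheared_product(1)[OF this this k]] show ?thesis
    by (simp add: lag_product_def case_prod_beta' norm_mult power_mult_distrib norm_power)
qed

text \<open>
  For fixed \<open>\<tau>\<close> the integration over \<open>u\<close> is Parseval's formula. Square integrability of the lag
  products holds only for almost every \<open>\<tau>\<close> and is therefore a hypothesis.
\<close>
lemma ambiguity_inner_u:
  assumes [measurable]: "x \<in> borel_measurable borel" "y \<in> borel_measurable borel"
    and x: "integrable lborel (\<lambda>t. (cmod (x t))\<^sup>2)" and y: "integrable lborel (\<lambda>t. (cmod (y t))\<^sup>2)"
    and hx: "integrable lborel (\<lambda>t. (cmod (lag_product k x \<tau> t))\<^sup>2)"
    and hy: "integrable lborel (\<lambda>t. (cmod (lag_product k y \<tau> t))\<^sup>2)" and c: "c \<noteq> 0"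
  shows "integrable lborel (\<lambda>u. (cmod (ambiguity k b c x \<tau> u))\<^sup>2)"
    and "(\<integral>u. (cmod (ambiguity k b c x \<tau> u))\<^sup>2 \<partial>lborel)
      = 2 * pi / \<bar>c\<bar> * (\<integral>t. (cmod (lag_product k x \<tau> t))\<^sup>2 \<partial>lborel)"
    and "(\<integral>u. ambiguity k b c x \<tau> u * cnj (ambiguity k b c y \<tau> u) \<partial>lborel)
      = of_real (2 * pi / \<bar>c\<bar>) * (\<integral>t. lag_product k x \<tau> t * cnj (lag_product k y \<tau> t) \<partial>lborel)"
proof -
  note X = integrable_lag_product[OF _ x, of k \<tau>] note Y = integrable_lag_product[OF _ y, of k \<tau>]
  have Px: "integrable lborel (\<lambda>\<xi>. (cmod (fourier (lag_product k x \<tau>) \<xi>))\<^sup>2)"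
    "(\<integral>\<xi>. (cmod (fourier (lag_product k x \<tau>) \<xi>))\<^sup>2 \<partial>lborel) = 2 * pi * (\<integral>t. (cmod (lag_product k x \<tau> t))\<^sup>2 \<partial>lborel)"
    using X hx by (auto intro!: Plancherel_L1_L2)
  have scale: "(\<integral>u. f (b * \<tau> - c * u) \<partial>lborel) = (1 / \<bar>c\<bar>) *\<^sub>R (\<integral>u. f u \<partial>lborel)"
    for f :: "real \<Rightarrow> 'c :: {banach, second_countable_topology}"
    using lborel_integral_real_affine[of "- c" f "b * \<tau>"] c by simp
  show "integrable lborel (\<lambda>u. (cmod (ambiguity k b c x \<tau> u))\<^sup>2)"
    using lborel_integrable_real_affine[OF Px(1), of "- c" "b * \<tau>"] c by (simp add: ambiguity_def)
  show "(\<integral>u. (cmod (ambiguity k b c x \<tau> u))\<^sup>2 \<partial>lborel)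
      = 2 * pi / \<bar>c\<bar> * (\<integral>t. (cmod (lag_product k x \<tau> t))\<^sup>2 \<partial>lborel)"
    unfolding ambiguity_def scale[of "\<lambda>v. (cmod (fourier (lag_product k x \<tau>) v))\<^sup>2"] Px(2) by simp
  have "(\<integral>\<xi>. fourier (lag_product k x \<tau>) \<xi> * cnj (fourier (lag_product k y \<tau>) \<xi>) \<partial>lborel)
      = 2 * pi * (\<integral>t. lag_product k x \<tau> t * cnj (lag_product k y \<tau> t) \<partial>lborel)"
    using X Y hx hy by (intro Parseval_L1_L2) auto
  then show "(\<integral>u. ambiguity k b c x \<tau> u * cnj (ambiguity k b c y \<tau> u) \<partial>lborel)
      = of_real (2 * pi / \<bar>c\<bar>) * (\<integral>t. lag_product k x \<tau> t * cnj (lag_product k y \<tau> t) \<partial>lborel)"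
    unfolding ambiguity_def
      scale[of "\<lambda>v. fourier (lag_product k x \<tau>) v * cnj (fourier (lag_product k y \<tau>) v)"]
    by (simp add: scaleR_conv_of_real)
qed

lemma ambiguity_L2:
  assumes x[measurable]: "x \<in> borel_measurable borel" and x2: "integrable lborel (\<lambda>t. (cmod (x t))\<^sup>2)"
    and k: "k > 0" and c: "c \<noteq> 0"
  shows "integrable (lborel \<Otimes>\<^sub>M lborel) (\<lambda>(\<tau>, u). (cmod (ambiguity k b c x \<tau> u))\<^sup>2)"
proof (rule lborel_pair.Fubini_integrable)
  have AE: "AE \<tau> in lborel. integrable lborel (\<lambda>t. (cmod (lag_product k x \<tau> t))\<^sup>2)"
    using lborel_pair.AE_integrable_fst'[OF lag_product_L2[OF x x2 k]] by simp
  show "AE \<tau> in lborel. integrable lborel (\<lambda>u. case (\<tau>, u) of (\<tau>, u) \<Rightarrow> (cmod (ambiguity k b c x \<tau> u))\<^sup>2)"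
    using AE by eventually_elim (use ambiguity_inner_u(1)[OF x x x2 x2 _ _ c] in simp)
  have "integrable lborel (\<lambda>\<tau>. \<integral>u. (cmod (ambiguity k b c x \<tau> u))\<^sup>2 \<partial>lborel)"
  proof (rule integrable_cong_AE_imp)
    show "integrable lborel (\<lambda>\<tau>. 2 * pi / \<bar>c\<bar> * (\<integral>t. (cmod (lag_product k x \<tau> t))\<^sup>2 \<partial>lborel))"
      using lborel_pair.integrable_fst'[OF lag_product_L2[OF x x2 k]] by simp
    show "AE \<tau> in lborel. 2 * pi / \<bar>c\<bar> * (\<integral>t. (cmod (lag_product k x \<tau> t))\<^sup>2 \<partial>lborel)
        = (\<integral>u. (cmod (ambiguity k b c x \<tau> u))\<^sup>2 \<partial>lborel)"
      using AE by eventually_elim (use ambiguity_inner_u(2)[OF x x x2 x2 _ _ c] in simp)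
  qed measurable
  then show "integrable lborel (\<lambda>\<tau>. \<integral>u. norm (case (\<tau>, u) of (\<tau>, u) \<Rightarrow> (cmod (ambiguity k b c x \<tau> u))\<^sup>2) \<partial>lborel)"
    by simp
qed measurable

lemma Moyal_ambiguity:
  assumes x[measurable]: "x \<in> borel_measurable borel" and y[measurable]: "y \<in> borel_measurable borel"
    and x2: "integrable lborel (\<lambda>t. (cmod (x t))\<^sup>2)" and y2: "integrable lborel (\<lambda>t. (cmod (y t))\<^sup>2)"
    and k: "k > 0" and c: "c \<noteq> 0"
  shows "integrable (lborel \<Otimes>\<^sub>M lborel) (\<lambda>(\<tau>, u). ambiguity k b c x \<tau> u * cnj (ambiguity k b c y \<tau> u))"
    and "(\<integral>u. (\<integral>\<tau>. ambiguity k b c x \<tau> u * cnj (ambiguity k b c y \<tau> u) \<partial>lborel) \<partial>lborel)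
      = of_real (2 * pi / (\<bar>c\<bar> * k) * (cmod (\<integral>t. x t * cnj (y t) \<partial>lborel))\<^sup>2)"
proof -
  have "integrable (lborel \<Otimes>\<^sub>M lborel) (\<lambda>w. ambiguity k b c x (fst w) (snd w) * cnj (ambiguity k b c y (fst w) (snd w)))"
    using ambiguity_L2[OF x x2 k c, of b] ambiguity_L2[OF y y2 k c, of b]
    by (intro integrable_mult_of_L2) (simp_all add: case_prod_beta')
  then show I: "integrable (lborel \<Otimes>\<^sub>M lborel) (\<lambda>(\<tau>, u). ambiguity k b c x \<tau> u * cnj (ambiguity k b c y \<tau> u))"
    by (simp add: case_prod_beta')
  have AE: "AE \<tau> in lborel. (\<integral>u. ambiguity k b c x \<tau> u * cnj (ambiguity k b c y \<tau> u) \<partial>lborel)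
    = of_real (2 * pi / \<bar>c\<bar>) * (\<integral>t. lag_product k x \<tau> t * cnj (lag_product k y \<tau> t) \<partial>lborel)"
    using lborel_pair.AE_integrable_fst'[OF lag_product_L2[OF x x2 k]]
      lborel_pair.AE_integrable_fst'[OF lag_product_L2[OF y y2 k]]
    by eventually_elim (use ambiguity_inner_u(3)[OF x y x2 y2 _ _ c] in simp)
  let ?p = "\<lambda>t. x t * cnj (y t)" and ?q = "\<lambda>t. cnj (x t * cnj (y t))"
  have p: "integrable lborel ?p"
    using x2 y2 by (intro integrable_mult_of_L2) auto
  then have q: "integrable lborel ?q" by (rule integrable_cnj)
  \<comment> \<open>Regrouping the four factors by argument separates the variables of the shear.\<close>
  have h: "lag_product k x \<tau> t * cnj (lag_product k y \<tau> t) = ?p (t + k * (\<tau> / 2)) * ?q (t - k * (\<tau> / 2))" for \<tau> t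
    by (simp add: lag_product_def mult_ac)
  have "(\<integral>u. (\<integral>\<tau>. ambiguity k b c x \<tau> u * cnj (ambiguity k b c y \<tau> u) \<partial>lborel) \<partial>lborel)
    = (\<integral>\<tau>. (\<integral>u. ambiguity k b c x \<tau> u * cnj (ambiguity k b c y \<tau> u) \<partial>lborel) \<partial>lborel)"
    by (rule lborel_pair.Fubini_integral[OF I])
  also have "\<dots> = (\<integral>\<tau>. of_real (2 * pi / \<bar>c\<bar>) * (\<integral>t. lag_product k x \<tau> t * cnj (lag_product k y \<tau> t) \<partial>lborel) \<partial>lborel)"
  proof (rule integral_cong_AE[OF _ _ AE])
    show "(\<lambda>\<tau>. of_real (2 * pi / \<bar>c\<bar>) * (\<integral>t. lag_product k x \<tau> t * cnj (lag_product k y \<tau> t) \<partial>lborel))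
      \<in> borel_measurable lborel"
      unfolding lag_product_def by measurable
  qed measurable
  also have "\<dots> = of_real (2 * pi / \<bar>c\<bar>) * ((\<integral>t. ?p t \<partial>lborel) * (\<integral>t. ?q t \<partial>lborel) / k)"
    unfolding h integral_mult_right_zero integral_sheared_product(2)[OF p q k] ..
  also have "\<dots> = of_real (2 * pi / (\<bar>c\<bar> * k) * (cmod (\<integral>t. x t * cnj (y t) \<partial>lborel))\<^sup>2)"
    unfolding Bochner_Integration.integral_cnj complex_norm_square[symmetric] by simp
  finally show "(\<integral>u. (\<integral>\<tau>. ambiguity k b c x \<tau> u * cnj (ambiguity k b c y \<tau> u) \<partial>lborel) \<partial>lborel)
      = of_real (2 * pi / (\<bar>c\<bar> * k) * (cmod (\<integral>t. x t * cnj (y t) \<partial>lborel))\<^sup>2)" .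
qed

section \<open>Passage from Lebesgue measurable to Borel functions\<close>

lemma lebesgue_AE_borel_complex:
  fixes x :: "real \<Rightarrow> complex"
  assumes [measurable]: "x \<in> borel_measurable lebesgue"
  obtains x' where "x' \<in> borel_measurable borel" "AE t in lborel. x t = x' t"
proof -
  have "(\<lambda>t. Re (x t)) \<in> borel_measurable lebesgue" "(\<lambda>t. Im (x t)) \<in> borel_measurable lebesgue"
    by measurable
  then obtain r i where [measurable]: "r \<in> borel_measurable lborel" "i \<in> borel_measurable lborel"
    and r: "AE t in lborel. Re (x t) = r t" and i: "AE t in lborel. Im (x t) = i t"
    using completion_ex_borel_measurable_real[of "\<lambda>t. Re (x t)" lborel]
      completion_ex_borel_measurable_real[of "\<lambda>t. Im (x t)" lborel] by blast
  show ?thesis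
  proof (rule that[of "\<lambda>t. Complex (r t) (i t)"])
    have "(\<lambda>t. complex_of_real (r t) + \<i> * complex_of_real (i t)) \<in> borel_measurable borel"
      by measurable
    then show "(\<lambda>t. Complex (r t) (i t)) \<in> borel_measurable borel"
      by (simp add: Complex_eq)
    show "AE t in lborel. x t = Complex (r t) (i t)"
      using r i by eventually_elim (simp add: complex_eq_iff)
  qed
qed

lemma AE_lborel_translate:
  fixes P :: "real \<Rightarrow> bool"
  assumes "AE t in lborel. P t"
  shows "AE t in lborel. P (t + h)"
proof -
  obtain N where N: "{t. \<not> P t} \<subseteq> N" "N \<in> null_sets lborel"
    using assms by (auto elim!: AE_E simp: null_sets_def)
  have "AE t in lborel. t \<notin> N"
    using N(2) by (rule AE_not_in)
  moreover have "Measurable.pred borel (\<lambda>t. t \<notin> N)"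
    using N(2) by (auto simp: null_sets_def pred_def)
  ultimately have "AE t in lborel. h + 1 * t \<notin> N"
    by (intro AE_borel_affine) auto
  then show ?thesis
    by eventually_elim (use N(1) in \<open>auto simp: add.commute\<close>)
qed

text \<open>No measurability of \<open>f\<close> is needed, because Lebesgue measure is complete.\<close>
lemma lebesgue_integral_AE_borel:
  fixes f g :: "real \<Rightarrow> complex"
  assumes g: "g \<in> borel_measurable borel" and fg: "AE t in lborel. f t = g t"
  shows "integral\<^sup>L lebesgue f = integral\<^sup>L lborel g"
proof -
  have g': "g \<in> borel_measurable lebesgue"
    using g by (simp add: measurable_completion)
  have AE: "AE t in lebesgue. g t = f t"
    using fg by (auto simp: AE_completion_iff eq_commute)
  have "integral\<^sup>L lebesgue f = integral\<^sup>L lebesgue g"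
    using AE by (intro integral_cong_AE g' borel_measurable_AE[OF g' AE]) auto
  also have "\<dots> = integral\<^sup>L lborel g"
    using g by (intro integral_completion) simp
  finally show ?thesis .
qed

lemma NFrAF_eq_ambiguity:
  assumes x'[measurable]: "x' \<in> borel_measurable borel" and eq: "AE t in lborel. x t = x' t"
  shows "NFrAF \<theta> k x \<tau> u =
    of_real ((cmod (Omega \<theta>))\<^sup>2) * ambiguity k (k * cot \<theta>) (csc \<theta>) x' \<tau> u"
proof -
  let ?e = "\<lambda>t. t * (k * cot \<theta> * \<tau> - csc \<theta> * u)"
  have "AE t in lborel. x (t + k * (\<tau> / 2)) = x' (t + k * (\<tau> / 2))"
    using eq by (rule AE_lborel_translate)
  moreover have "AE t in lborel. x (t - k * (\<tau> / 2)) = x' (t - k * (\<tau> / 2))"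
    using AE_lborel_translate[OF eq, of "- (k * (\<tau> / 2))"] by simp
  ultimately have "AE t in lborel. x (t + k * (\<tau> / 2)) * cnj (x (t - k * (\<tau> / 2))) *
      exp (\<i> * complex_of_real (t * (k * \<tau> * cot \<theta> - u * csc \<theta>)))
    = lag_product k x' \<tau> t * cis (?e t)"
    by eventually_elim (simp add: lag_product_def cis_conv_exp mult_ac)
  moreover have "(\<lambda>t. lag_product k x' \<tau> t * cis (?e t)) \<in> borel_measurable borel"
    unfolding lag_product_def by measurable
  ultimately show ?thesis
    unfolding NFrAF_def ambiguity_def fourier_def by (subst lebesgue_integral_AE_borel) auto
qed

lemma L2_real_borel:
  assumes "x \<in> L2_real"
  obtains x' where "x' \<in> borel_measurable borel" "AE t in lborel. x t = x' t"
    "integrable lborel (\<lambda>t. (cmod (x' t))\<^sup>2)"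
proof -
  have x: "x \<in> borel_measurable lebesgue" "integrable lebesgue (\<lambda>t. (cmod (x t))\<^sup>2)"
    using assms by (auto simp: L2_real_def)
  obtain x' where x'[measurable]: "x' \<in> borel_measurable borel" and eq: "AE t in lborel. x t = x' t"
    using lebesgue_AE_borel_complex[OF x(1)] .
  have m: "(\<lambda>t. (cmod (x' t))\<^sup>2) \<in> borel_measurable lborel" by measurable
  have "integrable lebesgue (\<lambda>t. (cmod (x' t))\<^sup>2)"
  proof (rule integrable_cong_AE_imp[OF x(2)])
    show "(\<lambda>t. (cmod (x' t))\<^sup>2) \<in> borel_measurable lebesgue"
      using m by (rule measurable_completion)
    show "AE t in lebesgue. (cmod (x t))\<^sup>2 = (cmod (x' t))\<^sup>2"
      unfolding AE_completion_iff using eq by eventually_elim simp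
  qed
  then have "integrable lborel (\<lambda>t. (cmod (x' t))\<^sup>2)"
    using integrable_completion[OF m] by simp
  then show ?thesis using that x' eq by blast
qed

lemma L2_inner_eq_borel:
  assumes [measurable]: "x' \<in> borel_measurable borel" "y' \<in> borel_measurable borel"
    and x: "AE t in lborel. x t = x' t" and y: "AE t in lborel. y t = y' t"
  shows "L2_inner x y = (\<integral>t. x' t * cnj (y' t) \<partial>lborel)"
  unfolding L2_inner_def
proof (rule lebesgue_integral_AE_borel)
  show "AE t in lborel. x t * cnj (y t) = x' t * cnj (y' t)"
    using x y by eventually_elim simp
qed measurable

section \<open>The new fractional ambiguity function\<close>

lemma cmod_Omega_squared:
  assumes "sin \<theta> \<noteq> 0"
  shows "(cmod (Omega \<theta>))\<^sup>2 = \<bar>csc \<theta>\<bar> / (2 * pi)"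
proof -
  have "(cmod (1 - \<i> * complex_of_real (cot \<theta>)))\<^sup>2 = 1 + (cot \<theta>)\<^sup>2"
    by (simp add: cmod_power2)
  also have "\<dots> = (csc \<theta>)\<^sup>2"
    using assms sin_cos_squared_add[of \<theta>] by (simp add: cot_def csc_def field_simps)
  finally have "(cmod (1 - \<i> * complex_of_real (cot \<theta>)))\<^sup>2 = \<bar>csc \<theta>\<bar>\<^sup>2"
    by simp
  then have "cmod (1 - \<i> * complex_of_real (cot \<theta>)) = \<bar>csc \<theta>\<bar>"
    by (rule power2_eq_imp_eq) auto
  then show ?thesis
    by (simp add: Omega_def norm_divide)
qed

(* The library integral of a non-integrable function is 0, so the convergence implicit in
   the double integral is asserted as well. *)
theorem mainTheorem2:
  fixes x\<^sub>1 x\<^sub>2 :: "real \<Rightarrow> complex" and k \<theta> :: real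
  assumes "x\<^sub>1 \<in> L2_real" and "x\<^sub>2 \<in> L2_real"
    and "k \<in> \<rat>" and "k > 0"
    and "\<theta> \<notin> {of_int n * pi | n :: int. True}"
  shows "integrable (lebesgue :: (real \<times> real) measure)
           (\<lambda>(\<tau>, u). NFrAF \<theta> k x\<^sub>1 \<tau> u * cnj (NFrAF \<theta> k x\<^sub>2 \<tau> u)) \<and>
         (\<integral>u. (\<integral>\<tau>. NFrAF \<theta> k x\<^sub>1 \<tau> u * cnj (NFrAF \<theta> k x\<^sub>2 \<tau> u) \<partial>lebesgue) \<partial>lebesgue) =
           complex_of_real ((cmod (Omega \<theta>))\<^sup>2 / k * (cmod (L2_inner x\<^sub>1 x\<^sub>2))\<^sup>2)"
proof -
  obtain y\<^sub>1 where y1[measurable]: "y\<^sub>1 \<in> borel_measurable borel" and eq1: "AE t in lborel. x\<^sub>1 t = y\<^sub>1 t"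
    and y1_L2: "integrable lborel (\<lambda>t. (cmod (y\<^sub>1 t))\<^sup>2)"
    using L2_real_borel[OF assms(1)] .
  obtain y\<^sub>2 where y2[measurable]: "y\<^sub>2 \<in> borel_measurable borel" and eq2: "AE t in lborel. x\<^sub>2 t = y\<^sub>2 t"
    and y2_L2: "integrable lborel (\<lambda>t. (cmod (y\<^sub>2 t))\<^sup>2)"
    using L2_real_borel[OF assms(2)] .
  have sin: "sin \<theta> \<noteq> 0"
    using assms(5) by (auto simp: sin_zero_iff_int2)
  then have c: "csc \<theta> \<noteq> 0"
    by (simp add: csc_def)
  define W where "W = (cmod (Omega \<theta>))\<^sup>2"
  \<comment> \<open>One of the two factors \<open>|\<Omega>|\<^sup>2\<close> cancels the constant \<open>2 \<pi> / |c|\<close> of Parseval's formula.\<close>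
  have W: "W * (2 * pi / \<bar>csc \<theta>\<bar>) = 1"
    using c unfolding W_def cmod_Omega_squared[OF sin] by simp
  define A where "A = (\<lambda>\<tau> u. ambiguity k (k * cot \<theta>) (csc \<theta>) y\<^sub>1 \<tau> u * cnj (ambiguity k (k * cot \<theta>) (csc \<theta>) y\<^sub>2 \<tau> u))"
  have meas[measurable]: "(\<lambda>(\<tau>, u). A \<tau> u) \<in> borel_measurable (lborel \<Otimes>\<^sub>M lborel)"
    unfolding A_def by measurable
  have NFrAF: "NFrAF \<theta> k x\<^sub>1 \<tau> u * cnj (NFrAF \<theta> k x\<^sub>2 \<tau> u) = of_real (W\<^sup>2) * A \<tau> u" for \<tau> u
    unfolding NFrAF_eq_ambiguity[OF y1 eq1] NFrAF_eq_ambiguity[OF y2 eq2] A_def W_def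
    by (simp add: power2_eq_square mult_ac)
  have Moyal: "integrable (lborel \<Otimes>\<^sub>M lborel) (\<lambda>(\<tau>, u). A \<tau> u)"
    "(\<integral>u. (\<integral>\<tau>. A \<tau> u \<partial>lborel) \<partial>lborel)
      = of_real (2 * pi / (\<bar>csc \<theta>\<bar> * k) * (cmod (\<integral>t. y\<^sub>1 t * cnj (y\<^sub>2 t) \<partial>lborel))\<^sup>2)"
    unfolding A_def by (rule Moyal_ambiguity[OF y1 y2 y1_L2 y2_L2 assms(4) c])+
  have "integrable (lborel :: (real \<times> real) measure) (\<lambda>(\<tau>, u). of_real (W\<^sup>2) * A \<tau> u)"
    using Moyal(1) unfolding lborel_prod by (simp add: case_prod_beta')
  then have int: "integrable (lebesgue :: (real \<times> real) measure) (\<lambda>(\<tau>, u). of_real (W\<^sup>2) * A \<tau> u)"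
    using integrable_completion borel_measurable_integrable by blast
  have inner: "(\<integral>\<tau>. of_real (W\<^sup>2) * A \<tau> u \<partial>lebesgue) = of_real (W\<^sup>2) * (\<integral>\<tau>. A \<tau> u \<partial>lborel)" for u
    unfolding integral_mult_right_zero
    by (subst integral_completion) (simp_all add: A_def)
  have "(\<integral>u. (\<integral>\<tau>. of_real (W\<^sup>2) * A \<tau> u \<partial>lebesgue) \<partial>lebesgue)
    = of_real (W\<^sup>2) * (\<integral>u. (\<integral>\<tau>. A \<tau> u \<partial>lborel) \<partial>lborel)"
    unfolding inner unfolding integral_mult_right_zero by (subst integral_completion) simp_all
  also have "\<dots> = of_real (W * (W * (2 * pi / \<bar>csc \<theta>\<bar>)) / k * (cmod (L2_inner x\<^sub>1 x\<^sub>2))\<^sup>2)"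
    unfolding Moyal(2) L2_inner_eq_borel[OF y1 y2 eq1 eq2]
    by (simp add: power2_eq_square)
  also have "\<dots> = of_real (W / k * (cmod (L2_inner x\<^sub>1 x\<^sub>2))\<^sup>2)"
    unfolding W by simp
  finally show ?thesis
    using int unfolding NFrAF W_def by blast
qed

end
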